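(* Every projective diffeological vector space is a smooth direct summand of a coproduct in $\mathrm{DVect}$ of free diffeological vector spaces generated by open subsets of Euclidean spaces. That is, for every projective diffeological vector space $V$ there is a family $\{U_i\}_{i\in I}$ of open subsets of Euclidean spaces such that $V$ is a smooth direct summand of $\bigoplus_{i\in I}F(U_i)$.
   Context: A diffeological space is a set $X$ together with a specified set of functions $U\to X$ (called plots), for every open set $U\subseteq\mathbb{R}^n$ and every $n\in\mathbb{N}=\{0,1,2,\dots\}$, such that: (1) every constant map $U\to X$ is a plot; (2) if $U\to X$ is a plot and $V\to U$ is a smooth map between open subsets of Euclidean spaces, then $V\to U\to X$ is a plot; (3) if $U=\bigcup_i U_i$ is an open cover and $U\to X$ is a map whose restrictions to all $U_i$ are plots, then $U\to X$ is a plot. A map between diffeological spaces is smooth if composing with it sends plots to plots. Open subsets of Euclidean spaces carry the standard diffeology (plots are the usual smooth maps). Products carry the product diffeology (a map into a product is a plot iff all its components are plots). A diffeological vector space is a real vector space $V$ with a diffeology such that addition $V\times V\to V$ and scalar multiplication $\mathbb{R}\times V\to V$ are smooth. $\mathrm{DVect}$ is the category of diffeological vector spaces and smooth linear maps. The coproduct in $\mathrm{DVect}$ of a family $\{V_i\}_{i\in I}$ is the vector space $\bigoplus_{i\in I}V_i$ with the final diffeology for the canonical maps $\prod_{j\in J}V_j\to\bigoplus_{i\in I}V_i$, $J\subseteq I$ finite. For a diffeological space $X$, the free diffeological vector space $F(X)$ generated by $X$ is the free real vector space on the underlying set of $X$ (basis elements written $[x]$), with the diffeology generated by all maps $\mathbb{R}\times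 U_1\times\cdots\times\mathbb{R}\times U_n\to F(X)$, $(r_1,u_1,\dots,r_n,u_n)\mapsto r_1[p_1(u_1)]+\cdots+r_n[p_n(u_n)]$, for all $n\ge 1$ and all plots $p_i:U_i\to X$; it is the smallest diffeology making $F(X)$ a diffeological vector space and $X\to F(X)$, $x\mapsto[x]$, smooth. A linear subduction is a smooth linear surjection $f:W_1\to W_2$ of diffeological vector spaces such that every plot of $W_2$ locally (near each point of its domain) lifts along $f$ to a plot of $W_1$. A diffeological vector space $V$ is projective if for every linear subduction $f:W_1\to W_2$ and every smooth linear map $g:V\to W_2$ there exists a smooth linear map $h:V\to W_1$ with $g=f\circ h$. A diffeological vector space $V$ is a smooth direct summand of $W$ if $W\cong V\times X$ in $\mathrm{DVect}$ for some diffeological vector space $X$ (equivalently, there are smooth linear maps $q:V\to W$ and $p:W\to V$ with $p\circ q=\mathrm{id}_V$). *)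

theory Defs
  imports "HOL-Analysis.Analysis" "HOL-Analysis.Finite_Function_Topology"
begin

section \<open>Smooth maps between open subsets of Euclidean spaces\<close>

text \<open>
  The dimension has to vary inside the definition of a diffeology, so a point of R^n is an element
  of the topological space \<^const>\<open>Euclidean_space\<close> \<open>n\<close>, i.e. a real sequence
  vanishing from index \<open>n\<close> on. Its topology is the subspace topology of the product topology,
  so that \<^const>\<open>continuous_on\<close> below is ordinary continuity on R^n.
\<close>

type_synonym pt = "nat \<Rightarrow> real"

definition partial_differentiable :: "nat \<Rightarrow> (pt \<Rightarrow> real) \<Rightarrow> pt \<Rightarrow> bool" where
  "partial_differentiable i f x \<longleftrightarrow> (\<lambda>t. f (x(i := t))) differentiable (at (x i))"

definition partial_deriv :: "nat \<Rightarrow> (pt \<Rightarrow> real) \<Rightarrow> pt \<Rightarrow> real" where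
  "partial_deriv i f x = deriv (\<lambda>t. f (x(i := t))) (x i)"

text \<open>\<open>C_diff k n U f\<close>: \<open>f\<close> is of class \<open>C^k\<close> on the open subset \<open>U\<close> of R^n
  (values of \<open>f\<close> off \<open>U\<close> are irrelevant).\<close>

primrec C_diff :: "nat \<Rightarrow> nat \<Rightarrow> pt set \<Rightarrow> (pt \<Rightarrow> real) \<Rightarrow> bool" where
  "C_diff 0 n U f \<longleftrightarrow> continuous_on U f"
| "C_diff (Suc k) n U f \<longleftrightarrow>
     continuous_on U f \<and>
     (\<forall>i<n. (\<forall>x\<in>U. partial_differentiable i f x) \<and> C_diff k n U (partial_deriv i f))"

definition smooth_fun :: "nat \<Rightarrow> pt set \<Rightarrow> (pt \<Rightarrow> real) \<Rightarrow> bool" where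
  "smooth_fun n U f \<longleftrightarrow> (\<forall>k. C_diff k n U f)"

definition smooth_open_map :: "nat \<Rightarrow> pt set \<Rightarrow> nat \<Rightarrow> pt set \<Rightarrow> (pt \<Rightarrow> pt) \<Rightarrow> bool" where
  "smooth_open_map m V n U g \<longleftrightarrow>
     openin (Euclidean_space m) V \<and> openin (Euclidean_space n) U \<and> g ` V \<subseteq> U \<and>
     (\<forall>i<n. smooth_fun m V (\<lambda>x. g x i))"


section \<open>Diffeological spaces\<close>

text \<open>The triple \<open>(n, U, p)\<close> stands for the map \<open>p : U \<rightarrow> X\<close> with \<open>U\<close> an open subset of R^n.\<close>

type_synonym 'a plot = "nat \<times> pt set \<times> (pt \<Rightarrow> 'a)"

record 'a diffspace =
  points :: "'a set"
  plots :: "'a plot set"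

text \<open>
  The second clause is not an axiom of diffeology: since HOL functions are total, it says that
  the values of \<open>p\<close> off \<open>U\<close> do not matter, so that \<open>(n, U, p)\<close> really encodes a map on \<open>U\<close>.
  The covering family in the last clause may be empty.
\<close>

definition diffeological_space :: "'a diffspace \<Rightarrow> bool" where
  "diffeological_space X \<longleftrightarrow>
     (\<forall>n U p. (n, U, p) \<in> plots X \<longrightarrow> openin (Euclidean_space n) U \<and> p ` U \<subseteq> points X) \<and>
     (\<forall>n U p q. (n, U, p) \<in> plots X \<and> (\<forall>u\<in>U. p u = q u) \<longrightarrow> (n, U, q) \<in> plots X) \<and>
     (\<forall>n U x. openin (Euclidean_space n) U \<and> x \<in> points X \<longrightarrow> (n, U, \<lambda>_. x) \<in> plots X) \<and>
     (\<forall>n U p m V g. (n, U, p) \<in> plots X \<and> smooth_open_map m V n U g \<longrightarrow>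
        (m, V, p \<circ> g) \<in> plots X) \<and>
     (\<forall>n \<U> p. (\<forall>U\<in>\<U>. (n, U, p) \<in> plots X) \<longrightarrow> (n, \<Union>\<U>, p) \<in> plots X)"

definition smooth_map :: "'a diffspace \<Rightarrow> 'b diffspace \<Rightarrow> ('a \<Rightarrow> 'b) \<Rightarrow> bool" where
  "smooth_map X Y f \<longleftrightarrow>
     f ` points X \<subseteq> points Y \<and>
     (\<forall>n U p. (n, U, p) \<in> plots X \<longrightarrow> (n, U, f \<circ> p) \<in> plots Y)"

definition open_diffspace :: "nat \<Rightarrow> pt set \<Rightarrow> pt diffspace" where
  "open_diffspace n U = \<lparr>points = U, plots = {(m, V, p). smooth_open_map m V n U p}\<rparr>"

definition real_diffspace :: "real diffspace" where
  "real_diffspace =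
     \<lparr>points = UNIV, plots = {(m, V, p). openin (Euclidean_space m) V \<and> smooth_fun m V p}\<rparr>"

definition prod_diffspace :: "'a diffspace \<Rightarrow> 'b diffspace \<Rightarrow> ('a \<times> 'b) diffspace" where
  "prod_diffspace X Y =
     \<lparr>points = points X \<times> points Y,
      plots = {(n, U, p). (n, U, fst \<circ> p) \<in> plots X \<and> (n, U, snd \<circ> p) \<in> plots Y}\<rparr>"

definition Pi_diffspace :: "'j set \<Rightarrow> ('j \<Rightarrow> 'a diffspace) \<Rightarrow> ('j \<Rightarrow> 'a) diffspace" where
  "Pi_diffspace J X =
     \<lparr>points = (\<Pi>\<^sub>E j\<in>J. points (X j)),
      plots = {(n, U, p). openin (Euclidean_space n) U \<and>
                 p ` U \<subseteq> (\<Pi>\<^sub>E j\<in>J. points (X j)) \<and>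
                 (\<forall>j\<in>J. (n, U, \<lambda>u. p u j) \<in> plots (X j))}\<rparr>"

text \<open>The final diffeology on \<open>S\<close> for a set of maps \<open>f : Y \<rightarrow> S\<close> out of diffeological spaces:
  the smallest diffeology on \<open>S\<close> for which all these maps are smooth.\<close>

definition final_diffspace :: "'b set \<Rightarrow> ('y diffspace \<times> ('y \<Rightarrow> 'b)) set \<Rightarrow> 'b diffspace" where
  "final_diffspace S F =
     \<lparr>points = S,
      plots = \<Inter>{D. diffeological_space \<lparr>points = S, plots = D\<rparr> \<and>
                    (\<forall>(Y, f)\<in>F. smooth_map Y \<lparr>points = S, plots = D\<rparr> f)}\<rparr>"


section \<open>Diffeological vector spaces\<close>

text \<open>
  The underlying real vector space is a linear subspace of an ambient
  \<^class>\<open>real_vector\<close> type, which supplies the operations.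
\<close>

definition diffeological_vector_space :: "'a::real_vector diffspace \<Rightarrow> bool" where
  "diffeological_vector_space V \<longleftrightarrow>
     diffeological_space V \<and> subspace (points V) \<and>
     smooth_map (prod_diffspace V V) V (\<lambda>(x, y). x + y) \<and>
     smooth_map (prod_diffspace real_diffspace V) V (\<lambda>(r, x). r *\<^sub>R x)"

text \<open>Smooth linear maps, the morphisms of DVect; only the values on \<open>points V\<close> matter.\<close>

definition smooth_linear ::
    "'a::real_vector diffspace \<Rightarrow> 'b::real_vector diffspace \<Rightarrow> ('a \<Rightarrow> 'b) \<Rightarrow> bool" where
  "smooth_linear V W f \<longleftrightarrow>
     smooth_map V W f \<and>
     (\<forall>x\<in>points V. \<forall>y\<in>points V. f (x + y) = f x + f y) \<and>
     (\<forall>r. \<forall>x\<in>points V. f (r *\<^sub>R x) = r *\<^sub>R f x)"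

definition dvect_isomorphic ::
    "'a::real_vector diffspace \<Rightarrow> 'b::real_vector diffspace \<Rightarrow> bool" where
  "dvect_isomorphic V W \<longleftrightarrow>
     (\<exists>f g. smooth_linear V W f \<and> smooth_linear W V g \<and>
            (\<forall>x\<in>points V. g (f x) = x) \<and> (\<forall>y\<in>points W. f (g y) = y))"

text \<open>
  The complement \<open>X\<close> is sought in the ambient type of \<open>W\<close>. This is no restriction, because an
  isomorphism of \<open>W\<close> with the product identifies \<open>X\<close> with a subspace of \<open>W\<close>.
\<close>

definition smooth_direct_summand ::
    "'a::real_vector diffspace \<Rightarrow> 'b::real_vector diffspace \<Rightarrow> bool" where
  "smooth_direct_summand V W \<longleftrightarrow>
     (\<exists>X :: 'b diffspace. diffeological_vector_space X \<and>
        dvect_isomorphic W (prod_diffspace V X))"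

definition linear_subduction ::
    "'a::real_vector diffspace \<Rightarrow> 'b::real_vector diffspace \<Rightarrow> ('a \<Rightarrow> 'b) \<Rightarrow> bool" where
  "linear_subduction W1 W2 f \<longleftrightarrow>
     smooth_linear W1 W2 f \<and> f ` points W1 = points W2 \<and>
     (\<forall>n U p. (n, U, p) \<in> plots W2 \<longrightarrow>
        (\<forall>u\<in>U. \<exists>U' q. openin (Euclidean_space n) U' \<and> u \<in> U' \<and> U' \<subseteq> U \<and>
            (n, U', q) \<in> plots W1 \<and> (\<forall>x\<in>U'. f (q x) = p x)))"

text \<open>
  HOL cannot quantify over all types inside a formula, so projectivity is relative to a
  universe: \<open>W1\<close> and \<open>W2\<close> range over all diffeological vector spaces carried by
  subspaces of the type \<open>'w\<close>. A vector space is isomorphic to such a subspace iff its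
  dimension is at most that of \<open>'w\<close>. Being projective in the absolute sense implies
  \<open>projective_in TYPE('w)\<close> for every \<open>'w\<close>; so a theorem assuming the latter for a
  sufficiently large \<open>'w\<close> is at least as strong as the one assuming the former.
\<close>

definition projective_in ::
    "'w::real_vector itself \<Rightarrow> 'a::real_vector diffspace \<Rightarrow> bool" where
  "projective_in (T :: 'w itself) V \<longleftrightarrow>
     (\<forall>(W1 :: 'w diffspace) (W2 :: 'w diffspace) f g.
        diffeological_vector_space W1 \<and> diffeological_vector_space W2 \<and>
        linear_subduction W1 W2 f \<and> smooth_linear V W2 g \<longrightarrow>
        (\<exists>h. smooth_linear V W1 h \<and> (\<forall>x\<in>points V. g x = f (h x))))"

text \<open>
  The free real vector space on a set \<open>S\<close> consists of the finitely supported functions with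
  support in \<open>S\<close>; the basis vector \<open>[x]\<close> is \<open>single x 1\<close>, so \<open>r[x]\<close> is \<open>single x r\<close>.
  The domain of a generating map is the product of the open sets R and \<open>U i\<close>, for
  \<open>i < n\<close>, with the product diffeology, which is the standard diffeology of the product viewed as
  an open subset of a Euclidean space. The diffeology generated by these maps is therefore the
  final one.
\<close>

definition free_dvect :: "'x diffspace \<Rightarrow> ('x \<Rightarrow>\<^sub>0 real) diffspace" where
  "free_dvect X =
     final_diffspace {v. Poly_Mapping.keys v \<subseteq> points X}
       {(Pi_diffspace {..<n} (\<lambda>i. prod_diffspace real_diffspace (open_diffspace (m i) (U i))),
         \<lambda>w. \<Sum>i<n. Poly_Mapping.single (p i (snd (w i))) (fst (w i))) | (n :: nat) m U p.
        1 \<le> n \<and> (\<forall>i<n. (m i, U i, p i) \<in> plots X)}"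

definition coproduct_dvect ::
    "'i set \<Rightarrow> ('i \<Rightarrow> 'a::real_vector diffspace) \<Rightarrow> ('i \<Rightarrow>\<^sub>0 'a) diffspace" where
  "coproduct_dvect I V =
     final_diffspace
       {v. Poly_Mapping.keys v \<subseteq> I \<and> (\<forall>i\<in>I. Poly_Mapping.lookup v i \<in> points (V i))}
       {(Pi_diffspace J V, \<lambda>w. \<Sum>j\<in>J. Poly_Mapping.single j (w j)) | J.
        finite J \<and> J \<subseteq> I}"

end

theory Submission
  imports Defs
begin

text \<open>
  Every plot \<open>p : U \<rightarrow> V\<close> extends to a smooth linear map \<open>F(U) \<rightarrow> V\<close>. Together these maps give a
  smooth linear map onto \<open>V\<close> from the coproduct of the \<open>F(U)\<close> over all plots, and it is a linear
  subduction because \<open>p\<close> lifts to \<open>u \<mapsto> [u]\<close> in the summand indexed by \<open>p\<close> itself. Projectivity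
  yields a smooth linear section, which splits off \<open>V\<close> with the kernel as complement. That the
  coproduct and the \<open>F(U)\<close> are diffeological vector spaces uses the local description of the plots
  of a final diffeology, and hence the chain rule for \<open>C^k\<close> functions.
\<close>

section \<open>Calculus on open subsets of Euclidean spaces\<close>

text \<open>Defining a final diffeology as an intersection gives its universal property cheaply but
  says nothing about single plots, while smoothness of addition concerns two arbitrary plots at
  once. So plots must be shown to be locally constant or locally of the form generator after plot.
  That this condition survives reparametrisation needs open preimages and composites of smooth maps;
  since C^k is defined by iterated partial derivatives, the chain rule has to be derived from those,
  without a total derivative. The second obstacle is size. Projectivity lifts only along subductions
  between spaces carried by the type \<open>'w\<close>, whereas \<open>V\<close> and the coproduct
  live in types of their own. The hypothesis embeds only the type of the coproduct into
  \<open>'w\<close>; \<open>V\<close> enters \<open>'w\<close> by first being placed inside the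
  coproduct by a linear section of the subduction, with no smoothness asked of it. Projectivity then
  upgrades it to a smooth one.\<close>

lemma openin_Euclidean_space_iff:
  "openin (Euclidean_space n) U \<longleftrightarrow> (\<exists>T. open T \<and> U = T \<inter> {x. \<forall>i\<ge>n. x i = 0})"
  by (auto simp: Euclidean_space_def openin_subtopology euclidean_product_topology)

lemma openin_Euclidean_space_zero:
  "openin (Euclidean_space n) U \<Longrightarrow> x \<in> U \<Longrightarrow> n \<le> i \<Longrightarrow> x i = 0"
  by (auto simp: openin_Euclidean_space_iff)

text \<open>A basic open set restricts every coordinate, but those from \<open>n\<close> on are 0
  for both points, so only \<open>n\<close> radii have to be bounded from below.\<close>

lemma openin_Euclidean_space_box:
  assumes U: "openin (Euclidean_space n) U" and x: "x \<in> U"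
  obtains d where "d > 0"
    "\<And>y. (\<And>i. n \<le> i \<Longrightarrow> y i = 0) \<Longrightarrow> (\<And>i. i < n \<Longrightarrow> \<bar>y i - x i\<bar> < d) \<Longrightarrow> y \<in> U"
proof -
  from U obtain T where T: "open T" "U = T \<inter> {x. \<forall>i\<ge>n. x i = 0}"
    by (auto simp: openin_Euclidean_space_iff)
  have "openin (product_topology (\<lambda>_. euclidean) UNIV) T"
    using T(1) by (simp add: euclidean_product_topology)
  from product_topology_open_contains_basis[OF this, of x] T x
  obtain X where X: "x \<in> (\<Pi>\<^sub>E i\<in>UNIV. X i)" "\<And>i. open (X i)" "(\<Pi>\<^sub>E i\<in>UNIV. X i) \<subseteq> T"
    by auto
  have "\<exists>e>0. \<forall>t. \<bar>t - x i\<bar> < e \<longrightarrow> t \<in> X i" for i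
  proof -
    have "x i \<in> X i" using X(1) by auto
    then show ?thesis using X(2)[of i] by (auto simp: open_real dist_real_def)
  qed
  then obtain e where e: "\<And>i. e i > 0" "\<And>i t. \<bar>t - x i\<bar> < e i \<Longrightarrow> t \<in> X i"
    by metis
  \<comment> \<open>The 1 keeps the set nonempty when \<open>n = 0\<close>.\<close>
  define d where "d = Min (insert 1 (e ` {..<n}))"
  show thesis
  proof (rule that[of d])
    show "d > 0" using e(1) by (auto simp: d_def)
    fix y :: pt
    assume y: "\<And>i. n \<le> i \<Longrightarrow> y i = 0" "\<And>i. i < n \<Longrightarrow> \<bar>y i - x i\<bar> < d"
    have "y i \<in> X i" for i
    proof (cases "i < n")
      case True
      then have "d \<le> e i" by (auto simp: d_def intro: Min_le)
      then show ?thesis using e(2) y(2)[OF True] by force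
    next
      case False
      then have "y i = x i" using y(1) openin_Euclidean_space_zero[OF U x] by simp
      then show ?thesis using X(1) by auto
    qed
    then show "y \<in> U" using X(3) T(2) y(1) by auto
  qed
qed

section \<open>Locality of partial derivatives and of the classes C^k\<close>

lemma eventually_fun_upd_in_open:
  assumes U: "openin (Euclidean_space n) U" and x: "x \<in> U" and i: "i < n"
  shows "\<forall>\<^sub>F t in nhds (x i). x(i := t) \<in> U"
proof -
  obtain d where d: "d > 0"
    "\<And>y. (\<And>i. n \<le> i \<Longrightarrow> y i = 0) \<Longrightarrow> (\<And>i. i < n \<Longrightarrow> \<bar>y i - x i\<bar> < d) \<Longrightarrow> y \<in> U"
    using openin_Euclidean_space_box[OF U x] by blast
  have "\<forall>t. dist t (x i) < d \<longrightarrow> x(i := t) \<in> U"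
    using d i openin_Euclidean_space_zero[OF U x] by (auto intro!: d(2) simp: dist_real_def)
  then show ?thesis using d(1) unfolding eventually_nhds_metric by blast
qed

lemma partial_cong:
  assumes U: "openin (Euclidean_space n) U" and x: "x \<in> U" and i: "i < n"
    and eq: "\<And>u. u \<in> U \<Longrightarrow> f u = g u"
  shows "partial_differentiable i f x \<longleftrightarrow> partial_differentiable i g x"
    and "partial_deriv i f x = partial_deriv i g x"
proof -
  have ev: "\<forall>\<^sub>F t in nhds (x i). f (x(i := t)) = g (x(i := t))"
    using eventually_fun_upd_in_open[OF U x i] by (rule eventually_mono) (rule eq)
  show "partial_deriv i f x = partial_deriv i g x"
    unfolding partial_deriv_def using ev by (rule deriv_cong_ev) simp
  show "partial_differentiable i f x \<longleftrightarrow> partial_differentiable i g x"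
    unfolding partial_differentiable_def real_differentiable_def
    using DERIV_cong_ev[OF refl ev refl] by simp
qed

lemma has_partial_deriv:
  "((\<lambda>t. f (x(i := t))) has_field_derivative D) (at (x i)) \<Longrightarrow>
     partial_differentiable i f x \<and> partial_deriv i f x = D"
  unfolding partial_differentiable_def partial_deriv_def
  using real_differentiable_def by (blast intro: DERIV_imp_deriv)

lemma partial_differentiableD:
  "partial_differentiable i f x \<Longrightarrow>
     ((\<lambda>t. f (x(i := t))) has_field_derivative partial_deriv i f x) (at (x i))"
  unfolding partial_differentiable_def partial_deriv_def
  by (metis DERIV_imp_deriv real_differentiable_def)

lemma C_diff_continuous: "C_diff k n U f \<Longrightarrow> continuous_on U f"
  by (cases k) auto

lemma C_diff_mono: "C_diff (Suc k) n U f \<Longrightarrow> C_diff k n U f"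
  by (induction k arbitrary: f) auto

text \<open>Formulas for derivatives hold only on \<open>U\<close>, whereas
  \<open>partial_deriv i f\<close> is a total function. This lemma lets an induction on
  \<open>k\<close> continue with the formula in place of the derivative.\<close>

lemma C_diff_cong:
  assumes U: "openin (Euclidean_space n) U" and "\<And>u. u \<in> U \<Longrightarrow> f u = g u" and "C_diff k n U f"
  shows "C_diff k n U g"
  using assms(2,3)
proof (induction k arbitrary: f g)
  case 0
  then show ?case using continuous_on_cong[of U U f g] by simp
next
  case (Suc k)
  have "continuous_on U g" using Suc.prems continuous_on_cong[of U U f g] by simp
  moreover have "C_diff k n U (partial_deriv i g)" if "i < n" for i
  proof (rule Suc.IH[of "partial_deriv i f"])
    show "partial_deriv i f u = partial_deriv i g u" if "u \<in> U" for u
      by (rule partial_cong(2)[OF U that \<open>i < n\<close> Suc.prems(1)])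
  qed (use Suc.prems that in simp)
  moreover have "partial_differentiable i g x" if "i < n" "x \<in> U" for i x
    using Suc.prems partial_cong(1)[OF U that(2,1), of f g] that by auto
  ultimately show ?case by simp
qed

text \<open>Near a point of \<open>U\<close>, the set \<open>U\<close> and all of R^n have the same
  neighbourhoods. The resulting condition at each point no longer mentions \<open>U\<close>, so it
  passes to unions.\<close>

lemma continuous_on_open_local:
  assumes "openin (Euclidean_space n) U"
  shows "continuous_on U f \<longleftrightarrow> (\<forall>x\<in>U. continuous (at x within {x. \<forall>i\<ge>n. x i = 0}) f)"
proof -
  from assms obtain T where T: "open T" "U = T \<inter> {x. \<forall>i\<ge>n. x i = 0}"
    by (auto simp: openin_Euclidean_space_iff)
  have "at x within U = at x within {x. \<forall>i\<ge>n. x i = 0}" if "x \<in> U" for x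
    by (rule at_within_nhd[of _ T]) (use that T in auto)
  then show ?thesis by (simp add: continuous_on_eq_continuous_within)
qed

lemma continuous_on_Union_open:
  assumes "\<And>U. U \<in> \<U> \<Longrightarrow> openin (Euclidean_space n) U" and "\<And>U. U \<in> \<U> \<Longrightarrow> continuous_on U f"
  shows "continuous_on (\<Union>\<U>) f"
proof -
  have "openin (Euclidean_space n) (\<Union>\<U>)" using assms(1) by blast
  then show ?thesis
    using assms(2) continuous_on_open_local[OF assms(1), of _ f]
    by (subst continuous_on_open_local) auto
qed

text \<open>\<open>partial_deriv\<close> does not refer to the domain, so at every level of the
  recursion continuity is the only thing to be glued.\<close>

lemma C_diff_Union:
  assumes op: "\<And>U. U \<in> \<U> \<Longrightarrow> openin (Euclidean_space n) U" and "\<And>U. U \<in> \<U> \<Longrightarrow> C_diff k n U f"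
  shows "C_diff k n (\<Union>\<U>) f"
  using assms(2)
proof (induction k arbitrary: f)
  case 0
  then show ?case using continuous_on_Union_open[of \<U> n f] op by simp
next
  case (Suc k)
  then show ?case using continuous_on_Union_open[of \<U> n f] op by simp
qed

lemma C_diff_subset:
  assumes "C_diff k n U f" "V \<subseteq> U"
  shows "C_diff k n V f"
  using assms(1)
proof (induction k arbitrary: f)
  case 0
  then show ?case using assms(2) continuous_on_subset by auto
next
  case (Suc k)
  then show ?case using assms(2) continuous_on_subset by fastforce
qed

section \<open>Algebra of C^k functions\<close>

lemma C_diff_const: "C_diff k n U (\<lambda>_. c)"
proof (induction k arbitrary: c)
  case (Suc k)
  have "partial_differentiable i (\<lambda>_. c) x \<and> partial_deriv i (\<lambda>_. c) x = 0" for i x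
    by (rule has_partial_deriv) auto
  then have "partial_deriv i (\<lambda>_. c) = (\<lambda>_. 0)" "partial_differentiable i (\<lambda>_. c) x" for i x
    by (auto simp: fun_eq_iff)
  then show ?case using Suc by simp
qed simp

lemma continuous_on_coordinate: "continuous_on U (\<lambda>x::pt. x j)"
  by (rule continuous_on_subset[OF continuous_on_product_coordinates]) simp

lemma C_diff_coordinate: "C_diff k n U (\<lambda>x. x j)"
proof (cases k)
  case (Suc l)
  have *: "partial_differentiable i (\<lambda>x. x j) x \<and>
      partial_deriv i (\<lambda>x. x j) x = (if i = j then 1 else 0)" for i x
    by (rule has_partial_deriv) (auto intro!: derivative_eq_intros)
  then have "partial_deriv i (\<lambda>x. x j) = (\<lambda>_. if i = j then 1 else 0)" for i
    by (auto simp: fun_eq_iff)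
  then show ?thesis using Suc * C_diff_const continuous_on_coordinate by simp
qed (simp add: continuous_on_coordinate)

lemma C_diff_add:
  assumes U: "openin (Euclidean_space n) U" and "C_diff k n U f" "C_diff k n U g"
  shows "C_diff k n U (\<lambda>x. f x + g x)"
  using assms(2,3)
proof (induction k arbitrary: f g)
  case 0
  then show ?case by (auto intro: continuous_on_add)
next
  case (Suc k)
  have *: "partial_differentiable i (\<lambda>x. f x + g x) x \<and>
      partial_deriv i (\<lambda>x. f x + g x) x = partial_deriv i f x + partial_deriv i g x"
    if "i < n" "x \<in> U" for i x
    by (rule has_partial_deriv) (use Suc.prems that partial_differentiableD in \<open>auto intro!: DERIV_add\<close>)
  have "C_diff k n U (partial_deriv i (\<lambda>x. f x + g x))" if "i < n" for i
    by (rule C_diff_cong[OF U _ Suc.IH[of "partial_deriv i f" "partial_deriv i g"]])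
      (use * that Suc.prems in auto)
  then show ?case using * Suc.prems by (auto intro: continuous_on_add)
qed

text \<open>The product rule pairs a derivative of one factor with the other factor itself, so the
  hypotheses must also be lowered by one class before the induction hypothesis applies to both
  summands.\<close>

lemma C_diff_mult:
  assumes U: "openin (Euclidean_space n) U" and "C_diff k n U f" "C_diff k n U g"
  shows "C_diff k n U (\<lambda>x. f x * g x)"
  using assms(2,3)
proof (induction k arbitrary: f g)
  case 0
  then show ?case by (auto intro: continuous_on_mult)
next
  case (Suc k)
  have *: "partial_differentiable i (\<lambda>x. f x * g x) x \<and>
      partial_deriv i (\<lambda>x. f x * g x) x = partial_deriv i f x * g x + partial_deriv i g x * f x"
    if "i < n" "x \<in> U" for i x
  proof (rule has_partial_deriv)
    have "((\<lambda>t. f (x(i := t))) has_field_derivative partial_deriv i f x) (at (x i))"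
      "((\<lambda>t. g (x(i := t))) has_field_derivative partial_deriv i g x) (at (x i))"
      using Suc.prems that partial_differentiableD by auto
    from DERIV_mult[OF this] show "((\<lambda>t. f (x(i := t)) * g (x(i := t))) has_field_derivative
        partial_deriv i f x * g x + partial_deriv i g x * f x) (at (x i))" by simp
  qed
  have "C_diff k n U (partial_deriv i (\<lambda>x. f x * g x))" if "i < n" for i
  proof (rule C_diff_cong[OF U _ C_diff_add[OF U]])
    show "C_diff k n U (\<lambda>x. partial_deriv i f x * g x)" "C_diff k n U (\<lambda>x. partial_deriv i g x * f x)"
      using Suc.prems Suc.prems[THEN C_diff_mono] that by (auto intro: Suc.IH)
  qed (use * that in auto)
  then show ?case using * Suc.prems by (auto intro: continuous_on_mult)
qed

lemma C_diff_sum: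
  assumes U: "openin (Euclidean_space n) U" and "\<And>j. j \<in> J \<Longrightarrow> C_diff k n U (f j)"
  shows "C_diff k n U (\<lambda>x. \<Sum>j\<in>J. f j x)"
  using assms(2)
  by (induction J rule: infinite_finite_induct) (auto intro: C_diff_const C_diff_add[OF U])

section \<open>Mean value theorem and chain rule\<close>

lemma mean_value_segment:
  fixes \<phi> \<phi>' :: "real \<Rightarrow> real"
  assumes D: "\<And>t. \<bar>t - a\<bar> \<le> \<bar>b - a\<bar> \<Longrightarrow> (\<phi> has_field_derivative \<phi>' t) (at t)"
  obtains t where "\<bar>t - a\<bar> \<le> \<bar>b - a\<bar>" "\<phi> b - \<phi> a = \<phi>' t * (b - a)"
proof -
  \<comment> \<open>The order of the endpoints is unknown in the application. The symmetric interval
    around \<open>a\<close> in the hypothesis contains the segment in either case, and the box used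
    in several variables is symmetric in the same way.\<close>
  consider "a = b" | "a < b" | "b < a" by linarith
  then show thesis
  proof cases
    case 1
    then show ?thesis using that[of a] by simp
  next
    case 2
    then have "\<exists>t>a. t < b \<and> \<phi> b - \<phi> a = (b - a) * \<phi>' t"
      by (intro MVT2 D) auto
    then obtain t where "t > a" "t < b" "\<phi> b - \<phi> a = (b - a) * \<phi>' t" by blast
    then show ?thesis using that[of t] by (simp add: mult.commute)
  next
    case 3
    then have "\<exists>t>b. t < a \<and> \<phi> a - \<phi> b = (a - b) * \<phi>' t"
      by (intro MVT2 D) auto
    then obtain t where "t > b" "t < a" "\<phi> a - \<phi> b = (a - b) * \<phi>' t" by blast
    then show ?thesis using that[of t] by (simp add: algebra_simps)
  qed
qed

text \<open>Change the coordinates of \<open>x\<close> into those of \<open>y\<close> one at a time and apply the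
  mean value theorem to each step.\<close>

lemma multivariate_mean_value:
  assumes pd: "\<And>i u. i < n \<Longrightarrow> u \<in> U \<Longrightarrow> partial_differentiable i f u"
    and box: "\<And>z. (\<And>i. n \<le> i \<Longrightarrow> z i = 0) \<Longrightarrow> (\<And>i. i < n \<Longrightarrow> \<bar>z i - x i\<bar> \<le> \<bar>y i - x i\<bar>) \<Longrightarrow> z \<in> U"
    and x0: "\<And>i. n \<le> i \<Longrightarrow> x i = 0" and y0: "\<And>i. n \<le> i \<Longrightarrow> y i = 0"
  shows "\<exists>\<xi>. (\<forall>j<n. \<xi> j \<in> U \<and> (\<forall>i. \<bar>\<xi> j i - x i\<bar> \<le> \<bar>y i - x i\<bar>)) \<and>
     f y - f x = (\<Sum>j<n. partial_deriv j f (\<xi> j) * (y j - x j))"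
proof -
  define z where "z j = (\<lambda>i. if i < j then y i else x i)" for j
  have "\<exists>w. w \<in> U \<and> (\<forall>i. \<bar>w i - x i\<bar> \<le> \<bar>y i - x i\<bar>) \<and>
      f (z (Suc j)) - f (z j) = partial_deriv j f w * (y j - x j)" if j: "j < n" for j
  proof -
    have inU: "(z j)(j := t) \<in> U" if "\<bar>t - x j\<bar> \<le> \<bar>y j - x j\<bar>" for t
      using that j x0 y0 by (intro box) (auto simp: z_def)
    have "((\<lambda>t. f ((z j)(j := t))) has_field_derivative partial_deriv j f ((z j)(j := t))) (at t)"
      if "\<bar>t - x j\<bar> \<le> \<bar>y j - x j\<bar>" for t
      using partial_differentiableD[OF pd[OF j inU[OF that]]] by simp
    then obtain t where t: "\<bar>t - x j\<bar> \<le> \<bar>y j - x j\<bar>"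
        "f ((z j)(j := y j)) - f ((z j)(j := x j)) = partial_deriv j f ((z j)(j := t)) * (y j - x j)"
      using mean_value_segment[of "x j" "y j" "\<lambda>t. f ((z j)(j := t))"
          "\<lambda>t. partial_deriv j f ((z j)(j := t))"] by blast
    have "(z j)(j := y j) = z (Suc j)" "(z j)(j := x j) = z j"
      by (auto simp: z_def fun_eq_iff less_Suc_eq)
    with t inU show ?thesis by (intro exI[of _ "(z j)(j := t)"]) (auto simp: z_def)
  qed
  then obtain \<xi> where \<xi>: "\<And>j. j < n \<Longrightarrow> \<xi> j \<in> U \<and> (\<forall>i. \<bar>\<xi> j i - x i\<bar> \<le> \<bar>y i - x i\<bar>) \<and>
      f (z (Suc j)) - f (z j) = partial_deriv j f (\<xi> j) * (y j - x j)"
    by metis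
  have "z 0 = x" "z n = y" using x0 y0 by (auto simp: z_def fun_eq_iff not_less)
  then have "f y - f x = (\<Sum>j<n. f (z (Suc j)) - f (z j))"
    using sum_lessThan_telescope[of "\<lambda>j. f (z j)" n] by simp
  also have "\<dots> = (\<Sum>j<n. partial_deriv j f (\<xi> j) * (y j - x j))"
    using \<xi> by (intro sum.cong) auto
  finally show ?thesis using \<xi> by blast
qed

lemma tendsto_coordinatewise:
  fixes g :: "'b \<Rightarrow> 'i \<Rightarrow> real"
  assumes "\<And>i. ((\<lambda>t. g t i) \<longlongrightarrow> l i) F"
  shows "(g \<longlongrightarrow> l) F"
proof -
  have "limitin (product_topology (\<lambda>_. euclidean) UNIV) g l F"
    using assms by (auto simp: limitin_componentwise)
  then show ?thesis by (simp add: euclidean_product_topology)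
qed

text \<open>The increment of \<open>f\<close> along the curve is a sum of partial derivatives at
  intermediate points, each multiplied by the increment of one coordinate. As \<open>t\<close> tends
  to \<open>s\<close> these points are squeezed towards \<open>\<gamma> s\<close>, and continuity of
  the partial derivatives identifies the limit of the difference quotients. A partial derivative of
  a composite is exactly such a derivative along a curve.\<close>

lemma DERIV_along_curve:
  fixes \<gamma> :: "real \<Rightarrow> pt"
  assumes U: "openin (Euclidean_space n) U"
    and pd: "\<And>i u. i < n \<Longrightarrow> u \<in> U \<Longrightarrow> partial_differentiable i f u"
    and cont: "\<And>i. i < n \<Longrightarrow> continuous_on U (partial_deriv i f)"
    and \<gamma>: "\<gamma> s \<in> U" "\<forall>\<^sub>F t in at s. \<gamma> t \<in> U"
    and D: "\<And>i. i < n \<Longrightarrow> ((\<lambda>t. \<gamma> t i) has_field_derivative \<gamma>' i) (at s)"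
  shows "((\<lambda>t. f (\<gamma> t)) has_field_derivative (\<Sum>j<n. partial_deriv j f (\<gamma> s) * \<gamma>' j)) (at s)"
proof -
  obtain d where d: "d > 0"
    "\<And>y. (\<And>i. n \<le> i \<Longrightarrow> y i = 0) \<Longrightarrow> (\<And>i. i < n \<Longrightarrow> \<bar>y i - \<gamma> s i\<bar> < d) \<Longrightarrow> y \<in> U"
    using openin_Euclidean_space_box[OF U \<gamma>(1)] by blast
  note zero = openin_Euclidean_space_zero[OF U]
  have lim: "((\<lambda>t. \<gamma> t i) \<longlongrightarrow> \<gamma> s i) (at s)" if "i < n" for i
    using DERIV_isCont[OF D[OF that]] by (simp add: isCont_def)
  have "\<forall>\<^sub>F t in at s. \<forall>i\<in>{..<n}. \<bar>\<gamma> t i - \<gamma> s i\<bar> < d"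
    using tendstoD[OF lim d(1)] by (intro eventually_ball_finite) (auto simp: dist_real_def)
  with \<gamma>(2) have "\<forall>\<^sub>F t in at s. \<exists>\<xi>. (\<forall>j<n. \<xi> j \<in> U \<and> (\<forall>i. \<bar>\<xi> j i - \<gamma> s i\<bar> \<le> \<bar>\<gamma> t i - \<gamma> s i\<bar>)) \<and>
     f (\<gamma> t) - f (\<gamma> s) = (\<Sum>j<n. partial_deriv j f (\<xi> j) * (\<gamma> t j - \<gamma> s j))"
  proof eventually_elim
    case (elim t)
    show ?case
    \<comment> \<open>For \<open>t\<close> close to \<open>s\<close> the whole box around
      \<open>\<gamma> s\<close> with the increments as radii lies in the box of radius
      \<open>d\<close>, hence in \<open>U\<close>.\<close>
    proof (rule multivariate_mean_value[OF pd])
      fix z :: pt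
      assume z: "\<And>i. n \<le> i \<Longrightarrow> z i = 0" "\<And>i. i < n \<Longrightarrow> \<bar>z i - \<gamma> s i\<bar> \<le> \<bar>\<gamma> t i - \<gamma> s i\<bar>"
      show "z \<in> U"
      proof (rule d(2)[OF z(1)])
        show "\<bar>z i - \<gamma> s i\<bar> < d" if "i < n" for i
          using z(2)[OF that] elim(2) that by (auto intro: le_less_trans)
      qed
    qed (use zero \<gamma>(1) elim in auto)
  qed
  then obtain \<xi> where "\<forall>\<^sub>F t in at s. (\<forall>j<n. \<xi> t j \<in> U \<and> (\<forall>i. \<bar>\<xi> t j i - \<gamma> s i\<bar> \<le> \<bar>\<gamma> t i - \<gamma> s i\<bar>)) \<and>
     f (\<gamma> t) - f (\<gamma> s) = (\<Sum>j<n. partial_deriv j f (\<xi> t j) * (\<gamma> t j - \<gamma> s j))"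
    by (auto simp: eventually_ex)
  note \<xi> = this
  have clim: "((\<lambda>t. partial_deriv j f (\<xi> t j)) \<longlongrightarrow> partial_deriv j f (\<gamma> s)) (at s)" if j: "j < n" for j
  proof -
    \<comment> \<open>All coordinates must converge, including those from \<open>n\<close> on:
      continuity of the partial derivative is with respect to the product topology. There the curve
      is constantly 0 near \<open>s\<close>.\<close>
    have "((\<lambda>t. \<xi> t j i) \<longlongrightarrow> \<gamma> s i) (at s)" for i
    proof -
      have "((\<lambda>t. \<gamma> t i - \<gamma> s i) \<longlongrightarrow> 0) (at s)"
      proof (cases "i < n")
        case True
        then show ?thesis using lim[OF True] by (simp add: LIM_zero)
      next
        case False
        have "\<forall>\<^sub>F t in at s. \<gamma> t i - \<gamma> s i = 0"
          using \<gamma>(2) by eventually_elim (simp add: zero[OF _ leI[OF False]] \<gamma>(1))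
        then show ?thesis by (rule tendsto_eventually)
      qed
      then have "((\<lambda>t. \<xi> t j i - \<gamma> s i) \<longlongrightarrow> 0) (at s)"
        by (rule Lim_null_comparison[rotated, OF tendsto_rabs_zero])
          (use \<xi> in eventually_elim, use j in auto)
      then show ?thesis by (simp add: LIM_zero_iff)
    qed
    then have "((\<lambda>t. \<xi> t j) \<longlongrightarrow> \<gamma> s) (at s)" by (rule tendsto_coordinatewise)
    moreover have "\<forall>\<^sub>F t in at s. \<xi> t j \<in> U" using \<xi> by eventually_elim (use j in auto)
    ultimately show ?thesis
      using continuous_on_tendsto_compose[OF cont[OF j] _ \<gamma>(1)] by blast
  qed
  have "((\<lambda>t. \<Sum>j<n. partial_deriv j f (\<xi> t j) * ((\<gamma> t j - \<gamma> s j) / (t - s)))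
      \<longlongrightarrow> (\<Sum>j<n. partial_deriv j f (\<gamma> s) * \<gamma>' j)) (at s)"
    using clim D by (intro tendsto_intros) (auto simp: has_field_derivative_iff)
  moreover have "\<forall>\<^sub>F t in at s. (\<Sum>j<n. partial_deriv j f (\<xi> t j) * ((\<gamma> t j - \<gamma> s j) / (t - s)))
      = (f (\<gamma> t) - f (\<gamma> s)) / (t - s)"
    using \<xi> by eventually_elim (auto simp: sum_divide_distrib)
  ultimately show ?thesis
    unfolding has_field_derivative_iff by (rule Lim_transform_eventually)
qed

lemma continuous_on_into_Euclidean_space:
  assumes U: "openin (Euclidean_space n) U" and gV: "g ` V \<subseteq> U"
    and g: "\<And>j. j < n \<Longrightarrow> continuous_on V (\<lambda>x. g x j)"
  shows "continuous_on V g"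
proof (rule continuous_on_coordinatewise_then_product)
  fix j
  have "continuous_on V (\<lambda>x. g x j) \<longleftrightarrow> continuous_on V (\<lambda>x. 0 :: real)" if "n \<le> j"
    using gV openin_Euclidean_space_zero[OF U _ that] by (intro continuous_on_cong) auto
  then show "continuous_on V (\<lambda>x. g x j)" using g by (cases "j < n") auto
qed

text \<open>By the chain rule, the derivative of the composite is a sum of products whose first
  factors are again composites with \<open>g\<close>, the outer function having one class less.
  Hence the induction keeps \<open>g\<close> fixed and lets \<open>f\<close> vary.\<close>

lemma C_diff_compose:
  assumes V: "openin (Euclidean_space m) V" and U: "openin (Euclidean_space n) U"
    and gV: "g ` V \<subseteq> U" and "\<And>j. j < n \<Longrightarrow> C_diff k m V (\<lambda>x. g x j)" and "C_diff k n U f"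
  shows "C_diff k m V (\<lambda>x. f (g x))"
  using assms(4,5)
proof (induction k arbitrary: f)
  case 0
  show ?case using continuous_on_compose2[OF _ continuous_on_into_Euclidean_space[OF U gV] gV] 0 by auto
next
  case (Suc k)
  have g: "C_diff k m V (\<lambda>x. g x j)" if "j < n" for j
    using C_diff_mono[OF Suc.prems(1)[OF that]] .
  have *: "partial_differentiable i (\<lambda>x. f (g x)) x \<and> partial_deriv i (\<lambda>x. f (g x)) x =
      (\<Sum>j<n. partial_deriv j f (g x) * partial_deriv i (\<lambda>x. g x j) x)" if i: "i < m" and x: "x \<in> V" for i x
  proof (rule has_partial_deriv)
    have "\<forall>\<^sub>F t in at (x i). x(i := t) \<in> V"
      using eventually_fun_upd_in_open[OF V x i] by (auto simp: eventually_at_filter elim: eventually_mono)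
    then have 1: "\<forall>\<^sub>F t in at (x i). g (x(i := t)) \<in> U"
      by eventually_elim (use gV in auto)
    have 2: "((\<lambda>t. g (x(i := t)) j) has_field_derivative partial_deriv i (\<lambda>x. g x j) x) (at (x i))"
      if "j < n" for j
      using Suc.prems(1)[OF that] i x by (auto intro!: partial_differentiableD[of i "\<lambda>x. g x j"])
    \<comment> \<open>The curve is \<open>\<lambda>t. g (x(i := t))\<close>, which passes through
      \<open>g x\<close> at the parameter \<open>x i\<close>.\<close>
    have "((\<lambda>t. f (g (x(i := t)))) has_field_derivative
      (\<Sum>j<n. partial_deriv j f (g (x(i := x i))) * partial_deriv i (\<lambda>x. g x j) x)) (at (x i))"
      by (rule DERIV_along_curve[OF U _ _ _ 1 2])
        (use Suc.prems(2) gV x C_diff_continuous in auto)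
    then show "((\<lambda>t. f (g (x(i := t)))) has_field_derivative
      (\<Sum>j<n. partial_deriv j f (g x) * partial_deriv i (\<lambda>x. g x j) x)) (at (x i))" by simp
  qed
  have "C_diff k m V (partial_deriv i (\<lambda>x. f (g x)))" if i: "i < m" for i
  proof (rule C_diff_cong[OF V _ C_diff_sum[OF V C_diff_mult[OF V]]])
    show "C_diff k m V (\<lambda>x. partial_deriv j f (g x))" if "j \<in> {..<n}" for j
      by (rule Suc.IH[OF g]) (use Suc.prems(2) that in auto)
    show "C_diff k m V (partial_deriv i (\<lambda>x. g x j))" if "j \<in> {..<n}" for j
      using Suc.prems(1)[of j] that i by simp
  qed (use * i in auto)
  moreover have "continuous_on V (\<lambda>x. f (g x))"
    by (rule C_diff_continuous[OF Suc.IH[OF g C_diff_mono[OF Suc.prems(2)]]])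
  ultimately show ?case using * by simp
qed

section \<open>Smooth maps between open sets\<close>

lemma smooth_fun_compose:
  assumes "smooth_open_map m V n U g" and "smooth_fun n U f"
  shows "smooth_fun m V (\<lambda>x. f (g x))"
  unfolding smooth_fun_def
proof
  show "C_diff k m V (\<lambda>x. f (g x))" for k
    by (rule C_diff_compose[where U = U and n = n])
      (use assms in \<open>simp_all add: smooth_fun_def smooth_open_map_def\<close>)
qed

lemma smooth_open_map_compose:
  assumes g: "smooth_open_map m V n U g" and h: "smooth_open_map l T m V h"
  shows "smooth_open_map l T n U (g \<circ> h)"
  using assms smooth_fun_compose[OF h, of "\<lambda>x. g x i" for i]
  by (force simp: smooth_open_map_def)

lemma openin_smooth_vimage:
  assumes g: "smooth_open_map m V n U g" and U': "openin (Euclidean_space n) U'"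
  shows "openin (Euclidean_space m) {v \<in> V. g v \<in> U'}"
proof -
  have "C_diff 0 m V (\<lambda>x. g x j)" if "j < n" for j
    using g that unfolding smooth_open_map_def smooth_fun_def by blast
  then have cont: "continuous_on V g"
    using continuous_on_into_Euclidean_space[of n U g V] g by (auto simp: smooth_open_map_def)
  obtain T where T: "open T" "U' = T \<inter> {x. \<forall>i\<ge>n. x i = 0}"
    using U' by (auto simp: openin_Euclidean_space_iff)
  obtain B where B: "open B" "B \<inter> V = g -` T \<inter> V"
    using cont T(1) unfolding continuous_on_open_invariant by blast
  obtain A where A: "open A" "V = A \<inter> {x. \<forall>i\<ge>m. x i = 0}"
    using g by (auto simp: smooth_open_map_def openin_Euclidean_space_iff)
  \<comment> \<open>Open subsets of R^n are only relatively open among all sequences. The vanishing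
    of the last coordinates is automatic for values of \<open>g\<close>, so the preimage is that of
    the ambient open set \<open>T\<close>.\<close>
  have "g v i = 0" if "v \<in> V" "n \<le> i" for v i
    using g that by (auto simp: smooth_open_map_def intro: openin_Euclidean_space_zero)
  then have "{v \<in> V. g v \<in> U'} = (B \<inter> A) \<inter> {x. \<forall>i\<ge>m. x i = 0}"
    using A(2) B(2) T(2) by auto
  then show ?thesis using open_Int[OF B(1) A(1)] by (auto simp: openin_Euclidean_space_iff)
qed

lemma smooth_fun_cong:
  "openin (Euclidean_space n) U \<Longrightarrow> (\<And>u. u \<in> U \<Longrightarrow> f u = g u) \<Longrightarrow> smooth_fun n U f \<Longrightarrow> smooth_fun n U g"
  unfolding smooth_fun_def using C_diff_cong[of n U f g] by blast

lemma smooth_fun_const: "smooth_fun n U (\<lambda>_. c)"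
  by (simp add: smooth_fun_def C_diff_const)

lemma smooth_fun_mult:
  "openin (Euclidean_space n) U \<Longrightarrow> smooth_fun n U f \<Longrightarrow> smooth_fun n U g \<Longrightarrow>
     smooth_fun n U (\<lambda>x. f x * g x)"
  by (simp add: smooth_fun_def C_diff_mult)

lemma smooth_fun_Union:
  "(\<And>U. U \<in> \<U> \<Longrightarrow> openin (Euclidean_space n) U) \<Longrightarrow> (\<And>U. U \<in> \<U> \<Longrightarrow> smooth_fun n U f) \<Longrightarrow>
     smooth_fun n (\<Union>\<U>) f"
  by (simp add: smooth_fun_def C_diff_Union)

text \<open>Read as the inclusion of \<open>V\<close> into \<open>U\<close>, this makes restriction
  of plots a case of reparametrisation.\<close>

lemma smooth_open_map_id:
  "openin (Euclidean_space n) U \<Longrightarrow> openin (Euclidean_space n) V \<Longrightarrow> V \<subseteq> U \<Longrightarrow>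
     smooth_open_map n V n U (\<lambda>u. u)"
  by (auto simp: smooth_open_map_def smooth_fun_def C_diff_coordinate)

section \<open>Diffeologies\<close>

lemma diffeological_spaceI:
  assumes "\<And>n U p. (n, U, p) \<in> plots X \<Longrightarrow> openin (Euclidean_space n) U \<and> p ` U \<subseteq> points X"
    and "\<And>n U p q. (n, U, p) \<in> plots X \<Longrightarrow> (\<And>u. u \<in> U \<Longrightarrow> p u = q u) \<Longrightarrow> (n, U, q) \<in> plots X"
    and "\<And>n U x. openin (Euclidean_space n) U \<Longrightarrow> x \<in> points X \<Longrightarrow> (n, U, \<lambda>_. x) \<in> plots X"
    and "\<And>n U p m V g. (n, U, p) \<in> plots X \<Longrightarrow> smooth_open_map m V n U g \<Longrightarrow> (m, V, p \<circ> g) \<in> plots X"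
    and "\<And>n \<U> p. (\<And>U. U \<in> \<U> \<Longrightarrow> (n, U, p) \<in> plots X) \<Longrightarrow> (n, \<Union>\<U>, p) \<in> plots X"
  shows "diffeological_space X"
  unfolding diffeological_space_def
  apply (intro conjI allI impI)
  subgoal using assms(1) by blast
  subgoal using assms(1) by blast
  subgoal using assms(2) by blast
  subgoal using assms(3) by blast
  subgoal using assms(4) by blast
  subgoal using assms(5) by blast
  done

context
  fixes X :: "'a diffspace"
  assumes X: "diffeological_space X"
begin

lemma plot_openin: "(n, U, p) \<in> plots X \<Longrightarrow> openin (Euclidean_space n) U"
  using X[unfolded diffeological_space_def, THEN conjunct1] by blast

lemma plot_in_points: "(n, U, p) \<in> plots X \<Longrightarrow> u \<in> U \<Longrightarrow> p u \<in> points X"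
  using X[unfolded diffeological_space_def, THEN conjunct1] by blast

lemma plot_cong: "(n, U, p) \<in> plots X \<Longrightarrow> (\<And>u. u \<in> U \<Longrightarrow> p u = q u) \<Longrightarrow> (n, U, q) \<in> plots X"
  using X[unfolded diffeological_space_def, THEN conjunct2, THEN conjunct1] by blast

lemma plot_const: "openin (Euclidean_space n) U \<Longrightarrow> x \<in> points X \<Longrightarrow> (n, U, \<lambda>_. x) \<in> plots X"
  using X[unfolded diffeological_space_def, THEN conjunct2, THEN conjunct2, THEN conjunct1] by blast

lemma plot_compose:
  "(n, U, p) \<in> plots X \<Longrightarrow> smooth_open_map m V n U g \<Longrightarrow> (m, V, p \<circ> g) \<in> plots X"
  using X[unfolded diffeological_space_def, THEN conjunct2, THEN conjunct2, THEN conjunct2, THEN conjunct1] by blast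

lemma plot_Union: "(\<And>U. U \<in> \<U> \<Longrightarrow> (n, U, p) \<in> plots X) \<Longrightarrow> (n, \<Union>\<U>, p) \<in> plots X"
  using X[unfolded diffeological_space_def, THEN conjunct2, THEN conjunct2, THEN conjunct2, THEN conjunct2] by blast

lemma plot_restrict:
  assumes "(n, U, p) \<in> plots X" "openin (Euclidean_space n) U'" "U' \<subseteq> U"
  shows "(n, U', p) \<in> plots X"
  using plot_compose[OF assms(1) smooth_open_map_id[OF plot_openin[OF assms(1)] assms(2,3)]]
  by (simp add: comp_def)

lemma plot_local:
  assumes "\<And>u. u \<in> U \<Longrightarrow> \<exists>U'. u \<in> U' \<and> U' \<subseteq> U \<and> (n, U', p) \<in> plots X"
  shows "(n, U, p) \<in> plots X"
proof -
  have "(n, \<Union>{U'. U' \<subseteq> U \<and> (n, U', p) \<in> plots X}, p) \<in> plots X"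
    by (rule plot_Union) simp
  moreover have "\<Union>{U'. U' \<subseteq> U \<and> (n, U', p) \<in> plots X} = U"
    using assms by blast
  ultimately show ?thesis by simp
qed

end

lemma smooth_map_plot:
  "smooth_map X Y f \<Longrightarrow> (n, U, p) \<in> plots X \<Longrightarrow> (n, U, \<lambda>u. f (p u)) \<in> plots Y"
  unfolding smooth_map_def comp_def by blast

lemma diffeological_real: "diffeological_space real_diffspace"
proof (rule diffeological_spaceI)
  show "(n, U, q) \<in> plots real_diffspace"
    if "(n, U, p) \<in> plots real_diffspace" "\<And>u. u \<in> U \<Longrightarrow> p u = q u" for n U and p q :: "pt \<Rightarrow> real"
    using that smooth_fun_cong[of n U p q] by (auto simp: real_diffspace_def)
  show "(m, V, p \<circ> g) \<in> plots real_diffspace"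
    if "(n, U, p) \<in> plots real_diffspace" "smooth_open_map m V n U g" for n U m V g and p :: "pt \<Rightarrow> real"
    using that smooth_fun_compose[of m V n U g p]
    by (auto simp: real_diffspace_def comp_def smooth_open_map_def)
qed (auto simp: real_diffspace_def smooth_fun_const intro!: smooth_fun_Union)

lemma diffeological_open:
  assumes S: "openin (Euclidean_space n) S"
  shows "diffeological_space (open_diffspace n S)"
proof (rule diffeological_spaceI)
  show "(m, U, q) \<in> plots (open_diffspace n S)"
    if "(m, U, p) \<in> plots (open_diffspace n S)" "\<And>u. u \<in> U \<Longrightarrow> p u = q u" for m U p q
    using that smooth_fun_cong[of m U "\<lambda>x. p x i" "\<lambda>x. q x i" for i]
    by (auto simp: open_diffspace_def smooth_open_map_def)
  show "(m, V, p \<circ> g) \<in> plots (open_diffspace n S)"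
    if "(l, U, p) \<in> plots (open_diffspace n S)" "smooth_open_map m V l U g" for l U m V p g
    using that smooth_open_map_compose[of l U n S p m V g] by (auto simp: open_diffspace_def)
  show "(m, \<Union>\<U>, p) \<in> plots (open_diffspace n S)"
    if *: "\<And>U. U \<in> \<U> \<Longrightarrow> (m, U, p) \<in> plots (open_diffspace n S)" for m \<U> p
    using * S unfolding open_diffspace_def smooth_open_map_def
    by (auto intro!: smooth_fun_Union)
qed (use S in \<open>auto simp: open_diffspace_def smooth_open_map_def smooth_fun_const\<close>)

lemma diffeological_prod:
  assumes X: "diffeological_space X" and Y: "diffeological_space Y"
  shows "diffeological_space (prod_diffspace X Y)"
proof (rule diffeological_spaceI)
  show "openin (Euclidean_space n) U \<and> p ` U \<subseteq> points (prod_diffspace X Y)"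
    if "(n, U, p) \<in> plots (prod_diffspace X Y)" for n U p
    using that plot_openin[OF X] plot_in_points[OF X] plot_in_points[OF Y]
    by (fastforce simp: prod_diffspace_def mem_Times_iff)
  show "(n, U, q) \<in> plots (prod_diffspace X Y)"
    if "(n, U, p) \<in> plots (prod_diffspace X Y)" "\<And>u. u \<in> U \<Longrightarrow> p u = q u" for n U p q
    using that plot_cong[OF X, of n U "fst \<circ> p" "fst \<circ> q"] plot_cong[OF Y, of n U "snd \<circ> p" "snd \<circ> q"]
    by (auto simp: prod_diffspace_def)
  show "(n, U, \<lambda>_. x) \<in> plots (prod_diffspace X Y)"
    if "openin (Euclidean_space n) U" "x \<in> points (prod_diffspace X Y)" for n U x
    using that plot_const[OF X] plot_const[OF Y] by (auto simp: prod_diffspace_def comp_def)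
  show "(m, V, p \<circ> g) \<in> plots (prod_diffspace X Y)"
    if "(n, U, p) \<in> plots (prod_diffspace X Y)" "smooth_open_map m V n U g" for n U p m V g
    using that plot_compose[OF X] plot_compose[OF Y]
    by (auto simp: prod_diffspace_def comp_assoc[symmetric])
  show "(n, \<Union>\<U>, p) \<in> plots (prod_diffspace X Y)"
    if "\<And>U. U \<in> \<U> \<Longrightarrow> (n, U, p) \<in> plots (prod_diffspace X Y)" for n \<U> p
    using that plot_Union[OF X] plot_Union[OF Y] by (auto simp: prod_diffspace_def)
qed

lemma diffeological_Pi:
  assumes X: "\<And>j. j \<in> J \<Longrightarrow> diffeological_space (X j)"
  shows "diffeological_space (Pi_diffspace J X)"
proof (rule diffeological_spaceI)
  show "(n, U, q) \<in> plots (Pi_diffspace J X)"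
    if pq: "(n, U, p) \<in> plots (Pi_diffspace J X)" "\<And>u. u \<in> U \<Longrightarrow> p u = q u" for n U p q
  proof -
    have "p ` U = q ` U" using pq(2) by (rule image_cong[OF refl])
    moreover have "(n, U, \<lambda>u. q u j) \<in> plots (X j)" if "j \<in> J" for j
      by (rule plot_cong[OF X[OF that], of _ _ "\<lambda>u. p u j"]) (use pq that in \<open>auto simp: Pi_diffspace_def\<close>)
    ultimately show ?thesis using pq(1) by (auto simp: Pi_diffspace_def)
  qed
  show "(m, V, p \<circ> g) \<in> plots (Pi_diffspace J X)"
    if pg: "(n, U, p) \<in> plots (Pi_diffspace J X)" "smooth_open_map m V n U g" for n U p m V g
  proof -
    have "(m, V, \<lambda>u. (p \<circ> g) u j) \<in> plots (X j)" if "j \<in> J" for j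
      using plot_compose[OF X[OF that], of n U "\<lambda>u. p u j" m V g] pg that
      by (auto simp: Pi_diffspace_def comp_def)
    moreover have "(p \<circ> g) ` V \<subseteq> (\<Pi>\<^sub>E j\<in>J. points (X j))"
      by (rule order_trans[of _ "p ` U"]) (use pg in \<open>auto simp: Pi_diffspace_def smooth_open_map_def\<close>)
    ultimately show ?thesis using pg(2) by (simp add: Pi_diffspace_def smooth_open_map_def)
  qed
  show "(n, \<Union>\<U>, p) \<in> plots (Pi_diffspace J X)"
    if *: "\<And>U. U \<in> \<U> \<Longrightarrow> (n, U, p) \<in> plots (Pi_diffspace J X)" for n \<U> p
    using * plot_Union[OF X] unfolding Pi_diffspace_def
    by (auto simp: image_subset_iff)
qed (auto simp: Pi_diffspace_def intro: plot_const X)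

text \<open>Points of the product are extensional functions, so \<open>restrict\<close> has to fix
  the values outside \<open>J\<close>.\<close>

lemma Pi_plotI:
  assumes "openin (Euclidean_space n) U" and "\<And>j. j \<in> J \<Longrightarrow> diffeological_space (X j)"
    and "\<And>j. j \<in> J \<Longrightarrow> (n, U, \<lambda>u. p u j) \<in> plots (X j)"
  shows "(n, U, \<lambda>u. restrict (p u) J) \<in> plots (Pi_diffspace J X)"
  using assms(1,3) plot_in_points[OF assms(2,3)] by (auto simp: Pi_diffspace_def cong: if_cong)

lemma Pi_plotD:
  "(n, U, p) \<in> plots (Pi_diffspace J X) \<Longrightarrow> j \<in> J \<Longrightarrow> (n, U, \<lambda>u. p u j) \<in> plots (X j)"
  by (auto simp: Pi_diffspace_def)

section \<open>Final diffeologies\<close>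

lemma points_final [simp]: "points (final_diffspace S F) = S"
  by (simp add: final_diffspace_def)

text \<open>Under these two conditions the indiscrete diffeology on \<open>S\<close> makes all maps
  of the family smooth, so the intersection defining the final diffeology is taken over a nonempty
  collection.\<close>

locale final_family =
  fixes S :: "'b set" and F :: "('y diffspace \<times> ('y \<Rightarrow> 'b)) set"
  assumes source: "(Y, f) \<in> F \<Longrightarrow> diffeological_space Y"
    and into: "(Y, f) \<in> F \<Longrightarrow> y \<in> points Y \<Longrightarrow> f y \<in> S"
begin

lemma diffeological_indiscrete:
  "diffeological_space \<lparr>points = S, plots = {(n, U, p). openin (Euclidean_space n) U \<and> p ` U \<subseteq> S}\<rparr>"
  by (rule diffeological_spaceI) (auto simp: smooth_open_map_def image_subset_iff)

lemma diffeological_final: "diffeological_space (final_diffspace S F)"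
proof -
  let ?\<D> = "{D. diffeological_space \<lparr>points = S, plots = D\<rparr> \<and>
                    (\<forall>(Y, f)\<in>F. smooth_map Y \<lparr>points = S, plots = D\<rparr> f)}"
  let ?I = "{(n, U, p). openin (Euclidean_space n) U \<and> p ` U \<subseteq> S}"
  have "smooth_map Y \<lparr>points = S, plots = ?I\<rparr> f" if "(Y, f) \<in> F" for Y f
    using into[OF that] plot_openin[OF source[OF that]] plot_in_points[OF source[OF that]]
    by (auto simp: smooth_map_def)
  \<comment> \<open>With no member in the collection, the intersection would be the set of all
    triples, whose domains need not even be open.\<close>
  then have I: "?I \<in> ?\<D>" using diffeological_indiscrete by blast
  have ds: "diffeological_space \<lparr>points = S, plots = D\<rparr>" if "D \<in> ?\<D>" for D
    using that by blast
  have pl: "plots (final_diffspace S F) = \<Inter>?\<D>"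
    by (simp add: final_diffspace_def)
  show ?thesis
  proof (rule diffeological_spaceI)
    show "openin (Euclidean_space n) U \<and> p ` U \<subseteq> points (final_diffspace S F)"
      if "(n, U, p) \<in> plots (final_diffspace S F)" for n U p
      using that I unfolding pl by auto
    show "(n, U, q) \<in> plots (final_diffspace S F)"
      if "(n, U, p) \<in> plots (final_diffspace S F)" "\<And>u. u \<in> U \<Longrightarrow> p u = q u" for n U p q
      using that plot_cong[OF ds, of _ n U p q] unfolding pl by auto
    show "(n, U, \<lambda>_. x) \<in> plots (final_diffspace S F)"
      if "openin (Euclidean_space n) U" "x \<in> points (final_diffspace S F)" for n U x
      using that plot_const[OF ds, of _ n U x] unfolding pl by auto
    show "(m, V, p \<circ> g) \<in> plots (final_diffspace S F)"
      if "(n, U, p) \<in> plots (final_diffspace S F)" "smooth_open_map m V n U g" for n U p m V g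
      using that plot_compose[OF ds, of _ n U p m V g] unfolding pl by auto
    show "(n, \<Union>\<U>, p) \<in> plots (final_diffspace S F)"
      if "\<And>U. U \<in> \<U> \<Longrightarrow> (n, U, p) \<in> plots (final_diffspace S F)" for n \<U> p
      using that plot_Union[OF ds, of _ \<U> n p] unfolding pl by auto
  qed
qed

lemma generator_smooth:
  assumes "(Y, f) \<in> F"
  shows "smooth_map Y (final_diffspace S F) f"
  using assms into by (fastforce simp: smooth_map_def final_diffspace_def)

lemma generator_plot:
  "(Y, f) \<in> F \<Longrightarrow> (n, U, q) \<in> plots Y \<Longrightarrow> (n, U, \<lambda>u. f (q u)) \<in> plots (final_diffspace S F)"
  using smooth_map_plot[OF generator_smooth] .

lemma final_plot_mem:
  assumes "(n, U, p) \<in> plots (final_diffspace S F)" and "diffeological_space \<lparr>points = S, plots = D\<rparr>"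
    and "\<And>Y f. (Y, f) \<in> F \<Longrightarrow> smooth_map Y \<lparr>points = S, plots = D\<rparr> f"
  shows "(n, U, p) \<in> D"
  using assms by (auto simp: final_diffspace_def)

text \<open>The maps into \<open>S\<close> that become plots of \<open>Z\<close> after
  \<open>\<phi>\<close> form a diffeology, the pullback along \<open>\<phi>\<close>. By hypothesis
  all generators are smooth for it, so it contains the final one.\<close>

lemma smooth_map_final:
  assumes Z: "diffeological_space Z" and \<phi>: "\<phi> ` S \<subseteq> points Z"
    and sm: "\<And>Y f. (Y, f) \<in> F \<Longrightarrow> smooth_map Y Z (\<lambda>y. \<phi> (f y))"
  shows "smooth_map (final_diffspace S F) Z \<phi>"
proof -
  let ?D = "{(n, U, p). p ` U \<subseteq> S \<and> (n, U, \<phi> \<circ> p) \<in> plots Z}"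
  have D: "diffeological_space \<lparr>points = S, plots = ?D\<rparr>"
  proof (rule diffeological_spaceI)
    show "(n, U, q) \<in> plots \<lparr>points = S, plots = ?D\<rparr>"
      if "(n, U, p) \<in> plots \<lparr>points = S, plots = ?D\<rparr>" "\<And>u. u \<in> U \<Longrightarrow> p u = q u" for n U p q
      using that plot_cong[OF Z, of n U "\<phi> \<circ> p" "\<phi> \<circ> q"] by (auto simp: image_subset_iff)
    show "(n, U, \<lambda>_. x) \<in> plots \<lparr>points = S, plots = ?D\<rparr>"
      if "openin (Euclidean_space n) U" "x \<in> points \<lparr>points = S, plots = ?D\<rparr>" for n U x
      using that \<phi> plot_const[OF Z, of n U "\<phi> x"] by (auto simp: comp_def)
    show "(m, V, p \<circ> g) \<in> plots \<lparr>points = S, plots = ?D\<rparr>"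
      if "(n, U, p) \<in> plots \<lparr>points = S, plots = ?D\<rparr>" "smooth_open_map m V n U g" for n U p m V g
      using that plot_compose[OF Z, of n U "\<phi> \<circ> p" m V g]
      by (auto simp: comp_assoc smooth_open_map_def image_subset_iff)
    show "(n, \<Union>\<U>, p) \<in> plots \<lparr>points = S, plots = ?D\<rparr>"
      if "\<And>U. U \<in> \<U> \<Longrightarrow> (n, U, p) \<in> plots \<lparr>points = S, plots = ?D\<rparr>" for n \<U> p
      using that plot_Union[OF Z, of \<U> n "\<phi> \<circ> p"] by (auto simp: image_subset_iff)
  qed (use plot_openin[OF Z] in auto)
  have "smooth_map Y \<lparr>points = S, plots = ?D\<rparr> f" if "(Y, f) \<in> F" for Y f
    using sm[OF that] into[OF that] plot_in_points[OF source[OF that]]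
    by (auto simp: smooth_map_def comp_def image_subset_iff)
  then show ?thesis
    using final_plot_mem[OF _ D] \<phi> by (auto simp: smooth_map_def)
qed

text \<open>The maps with this local property form a diffeology for which the generators are smooth,
  so every plot of the final diffeology is among them. The constant alternative covers points of
  \<open>S\<close> that no generator reaches.\<close>

lemma final_plot_local:
  assumes "(n, U, p) \<in> plots (final_diffspace S F)" and "u \<in> U"
  shows "\<exists>U'. openin (Euclidean_space n) U' \<and> u \<in> U' \<and> U' \<subseteq> U \<and>
    ((\<exists>c\<in>S. \<forall>x\<in>U'. p x = c) \<or> (\<exists>(Y, f)\<in>F. \<exists>q. (n, U', q) \<in> plots Y \<and> (\<forall>x\<in>U'. p x = f (q x))))"
proof -
  define L where "L n U' p \<longleftrightarrow> openin (Euclidean_space n) U' \<and>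
    ((\<exists>c\<in>S. \<forall>x\<in>U'. p x = c) \<or> (\<exists>(Y, f)\<in>F. \<exists>q. (n, U', q) \<in> plots Y \<and> (\<forall>x\<in>U'. p x = f (q x))))"
    for n U' p
  let ?D = "{(n, U, p). openin (Euclidean_space n) U \<and> p ` U \<subseteq> S \<and>
    (\<forall>u\<in>U. \<exists>U'. u \<in> U' \<and> U' \<subseteq> U \<and> L n U' p)}"
  have L_cong: "L n U' q" if "L n U' p" "\<And>x. x \<in> U' \<Longrightarrow> p x = q x" for n U' p q
    using that unfolding L_def by (auto split: prod.splits)
  \<comment> \<open>The local description of \<open>p\<close> on \<open>U'\<close> is pulled back to
    the preimage of \<open>U'\<close>. To compose with the plot \<open>q\<close>, whose domain is
    \<open>U'\<close>, the target of \<open>g\<close> must be cut down from \<open>U\<close> to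
    \<open>U'\<close>.\<close>
  have L_compose: "L m {v \<in> V. g v \<in> U'} (p \<circ> g)"
    if g: "smooth_open_map m V n U g" and L: "L n U' p" for m V n U g U' p
  proof -
    have op: "openin (Euclidean_space m) {v \<in> V. g v \<in> U'}"
      using openin_smooth_vimage[OF g] L by (auto simp: L_def)
    have "smooth_open_map m {v \<in> V. g v \<in> U'} n U g"
      using smooth_open_map_compose[OF g smooth_open_map_id[OF _ op]] g
      by (auto simp: smooth_open_map_def comp_def)
    then have g': "smooth_open_map m {v \<in> V. g v \<in> U'} n U' g"
      using L by (auto simp: L_def smooth_open_map_def)
    from L consider c where "c \<in> S" "\<forall>x\<in>U'. p x = c"
      | Y f q where "(Y, f) \<in> F" "(n, U', q) \<in> plots Y" "\<forall>x\<in>U'. p x = f (q x)"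
      unfolding L_def by blast
    then show ?thesis
    proof cases
      case 1
      then show ?thesis using op by (auto simp: L_def)
    next
      case 2
      then show ?thesis
        using op plot_compose[OF source[OF 2(1)] 2(2) g'] unfolding L_def by fastforce
    qed
  qed
  have D: "diffeological_space \<lparr>points = S, plots = ?D\<rparr>"
  proof (rule diffeological_spaceI)
    show "(n, U, q) \<in> plots \<lparr>points = S, plots = ?D\<rparr>"
      if pq: "(n, U, p) \<in> plots \<lparr>points = S, plots = ?D\<rparr>" "\<And>u. u \<in> U \<Longrightarrow> p u = q u" for n U p q
    proof -
      have "\<exists>U'. u \<in> U' \<and> U' \<subseteq> U \<and> L n U' q" if "u \<in> U" for u
      proof -
        from pq(1) that obtain U' where "u \<in> U'" "U' \<subseteq> U" "L n U' p" by auto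
        then show ?thesis using L_cong[of n U' p q] pq(2) by blast
      qed
      then show ?thesis using pq by (auto simp: image_subset_iff)
    qed
    show "(n, U, \<lambda>_. x) \<in> plots \<lparr>points = S, plots = ?D\<rparr>"
      if "openin (Euclidean_space n) U" "x \<in> points \<lparr>points = S, plots = ?D\<rparr>" for n U x
      using that by (auto simp: L_def)
    show "(m, V, p \<circ> g) \<in> plots \<lparr>points = S, plots = ?D\<rparr>"
      if pg: "(n, U, p) \<in> plots \<lparr>points = S, plots = ?D\<rparr>" "smooth_open_map m V n U g" for n U p m V g
    proof -
      have gV: "g v \<in> U" if "v \<in> V" for v
        using that pg(2) by (auto simp: smooth_open_map_def)
      have "\<exists>V'. v \<in> V' \<and> V' \<subseteq> V \<and> L m V' (p \<circ> g)" if "v \<in> V" for v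
      proof -
        from pg(1) gV[OF that] obtain U' where "g v \<in> U'" "L n U' p" by auto
        then show ?thesis using L_compose[OF pg(2), of U' p] that
          by (intro exI[of _ "{v \<in> V. g v \<in> U'}"]) auto
      qed
      then show ?thesis using pg gV by (auto simp: smooth_open_map_def)
    qed
    show "(n, \<Union>\<U>, p) \<in> plots \<lparr>points = S, plots = ?D\<rparr>"
      if pl: "\<And>U. U \<in> \<U> \<Longrightarrow> (n, U, p) \<in> plots \<lparr>points = S, plots = ?D\<rparr>" for n \<U> p
    proof -
      have "\<exists>U'. u \<in> U' \<and> U' \<subseteq> \<Union>\<U> \<and> L n U' p" if u: "u \<in> \<Union>\<U>" for u
      proof -
        from u obtain U where "U \<in> \<U>" "u \<in> U" by blast
        then have "\<exists>U'. u \<in> U' \<and> U' \<subseteq> U \<and> L n U' p" using pl[OF \<open>U \<in> \<U>\<close>] by auto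
        then show ?thesis using \<open>U \<in> \<U>\<close> by blast
      qed
      then show ?thesis using pl by (auto simp: image_subset_iff)
    qed
  qed auto
  have "smooth_map Y \<lparr>points = S, plots = ?D\<rparr> f" if "(Y, f) \<in> F" for Y f
  proof -
    have "L n U (f \<circ> p) \<and> openin (Euclidean_space n) U" if "(n, U, p) \<in> plots Y" for n U p
      using plot_openin[OF source[OF \<open>(Y, f) \<in> F\<close>] that] that \<open>(Y, f) \<in> F\<close> unfolding L_def
      by fastforce
    then show ?thesis
      using into[OF that] plot_in_points[OF source[OF that]]
      by (auto simp: smooth_map_def)
  qed
  from final_plot_mem[OF assms(1) D this] assms(2)
  have "\<exists>U'. u \<in> U' \<and> U' \<subseteq> U \<and> L n U' p" by simp
  then show ?thesis unfolding L_def by blast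
qed

end

section \<open>Diffeological vector spaces\<close>

lemma diffeological_vector_spaceI:
  assumes V: "diffeological_space V" and "subspace (points V)"
    and add: "\<And>n U p q. (n, U, p) \<in> plots V \<Longrightarrow> (n, U, q) \<in> plots V \<Longrightarrow> (n, U, \<lambda>u. p u + q u) \<in> plots V"
    and scale: "\<And>n U r p. smooth_fun n U r \<Longrightarrow> (n, U, p) \<in> plots V \<Longrightarrow> (n, U, \<lambda>u. r u *\<^sub>R p u) \<in> plots V"
  shows "diffeological_vector_space V"
  unfolding diffeological_vector_space_def
proof (intro conjI V assms(2))
  show "smooth_map (prod_diffspace V V) V (\<lambda>(x, y). x + y)"
    using add assms(2) by (auto simp: smooth_map_def prod_diffspace_def comp_def case_prod_beta subspace_add)
  show "smooth_map (prod_diffspace real_diffspace V) V (\<lambda>(r, x). r *\<^sub>R x)"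
    using scale assms(2)
    by (auto simp: smooth_map_def prod_diffspace_def real_diffspace_def comp_def case_prod_beta subspace_scale)
qed

context
  fixes V :: "'a::real_vector diffspace"
  assumes V: "diffeological_vector_space V"
begin

lemma dvect_diffeological: "diffeological_space V"
  and dvect_subspace: "subspace (points V)"
  using V by (auto simp: diffeological_vector_space_def)

lemma dvect_plot_add:
  assumes "(n, U, p) \<in> plots V" "(n, U, q) \<in> plots V"
  shows "(n, U, \<lambda>u. p u + q u) \<in> plots V"
proof -
  have "(n, U, \<lambda>u. (p u, q u)) \<in> plots (prod_diffspace V V)"
    using assms by (simp add: prod_diffspace_def comp_def)
  then show ?thesis
    using V smooth_map_plot[of "prod_diffspace V V" V "\<lambda>(x, y). x + y"]
    by (fastforce simp: diffeological_vector_space_def)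
qed

lemma dvect_plot_scale:
  assumes "smooth_fun n U r" "(n, U, p) \<in> plots V"
  shows "(n, U, \<lambda>u. r u *\<^sub>R p u) \<in> plots V"
proof -
  have "(n, U, \<lambda>u. (r u, p u)) \<in> plots (prod_diffspace real_diffspace V)"
    using assms plot_openin[OF dvect_diffeological]
    by (auto simp: prod_diffspace_def comp_def real_diffspace_def)
  then show ?thesis
    using V smooth_map_plot[of "prod_diffspace real_diffspace V" V "\<lambda>(r, x). r *\<^sub>R x"]
    by (fastforce simp: diffeological_vector_space_def)
qed

lemma dvect_plot_zero: "openin (Euclidean_space n) U \<Longrightarrow> (n, U, \<lambda>_. 0) \<in> plots V"
  by (intro plot_const[OF dvect_diffeological] subspace_0 dvect_subspace)

lemma dvect_plot_sum:
  assumes "openin (Euclidean_space n) U" and "\<And>j. j \<in> J \<Longrightarrow> (n, U, p j) \<in> plots V"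
  shows "(n, U, \<lambda>u. \<Sum>j\<in>J. p j u) \<in> plots V"
  using assms(2)
  by (induction J rule: infinite_finite_induct) (auto intro: dvect_plot_zero assms(1) dvect_plot_add)

end

text \<open>Smoothness of the operations is local, and locally every plot is zero or comes from a
  generator, so both operations need checking on generators only. Zero is exempt from
  \<open>cover\<close> because it may be out of reach: in the free space on an empty set, every
  generator has an empty source.\<close>

lemma diffeological_vector_space_final:
  fixes S :: "'b::real_vector set" and F :: "('y diffspace \<times> ('y \<Rightarrow> 'b)) set"
  assumes "final_family S F" and S: "subspace S"
    and cover: "\<And>s. s \<in> S \<Longrightarrow> s \<noteq> 0 \<Longrightarrow> \<exists>(Y, f)\<in>F. s \<in> f ` points Y"
    and add: "\<And>Y f Y' f' n U q q'. (Y, f) \<in> F \<Longrightarrow> (Y', f') \<in> F \<Longrightarrow> (n, U, q) \<in> plots Y \<Longrightarrow>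
      (n, U, q') \<in> plots Y' \<Longrightarrow> (n, U, \<lambda>u. f (q u) + f' (q' u)) \<in> plots (final_diffspace S F)"
    and scale: "\<And>Y f n U r q. (Y, f) \<in> F \<Longrightarrow> smooth_fun n U r \<Longrightarrow> (n, U, q) \<in> plots Y \<Longrightarrow>
      (n, U, \<lambda>u. r u *\<^sub>R f (q u)) \<in> plots (final_diffspace S F)"
  shows "diffeological_vector_space (final_diffspace S F)"
proof -
  interpret final_family S F by fact
  let ?W = "final_diffspace S F"
  note W = diffeological_final
  have loc: "\<exists>U'. openin (Euclidean_space n) U' \<and> u \<in> U' \<and> U' \<subseteq> U \<and>
    ((\<forall>x\<in>U'. p x = 0) \<or> (\<exists>Y f q. (Y, f) \<in> F \<and> (n, U', q) \<in> plots Y \<and> (\<forall>x\<in>U'. p x = f (q x))))"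
    if p: "(n, U, p) \<in> plots ?W" and u: "u \<in> U" for n U p u
  proof -
    obtain U' where U': "openin (Euclidean_space n) U'" "u \<in> U'" "U' \<subseteq> U"
      and "(\<exists>c\<in>S. \<forall>x\<in>U'. p x = c) \<or> (\<exists>(Y, f)\<in>F. \<exists>q. (n, U', q) \<in> plots Y \<and> (\<forall>x\<in>U'. p x = f (q x)))"
      using final_plot_local[OF p u] by blast
    then consider c where "c \<in> S" "\<forall>x\<in>U'. p x = c"
      | Y f q where "(Y, f) \<in> F" "(n, U', q) \<in> plots Y" "\<forall>x\<in>U'. p x = f (q x)"
      by blast
    then show ?thesis
    proof cases
      case 1
      show ?thesis
      \<comment> \<open>A nonzero constant is the image of a constant plot of some generator; only
        the constant 0 remains as a separate case.\<close>
      proof (cases "c = 0")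
        case False
        then obtain Y f y where "(Y, f) \<in> F" "y \<in> points Y" "c = f y"
          using cover[OF 1(1)] by blast
        then have "(Y, f) \<in> F \<and> (n, U', \<lambda>_. y) \<in> plots Y \<and> (\<forall>x\<in>U'. p x = f y)"
          using plot_const[OF source U'(1)] 1(2) by blast
        then show ?thesis using U' by blast
      qed (use 1 U' in blast)
    next
      case 2
      then show ?thesis using U' by blast
    qed
  qed
  show ?thesis
  proof (rule diffeological_vector_spaceI[OF W])
    show "subspace (points ?W)" using S by simp
  next
    fix n U p p'
    assume p: "(n, U, p) \<in> plots ?W" and p': "(n, U, p') \<in> plots ?W"
    show "(n, U, \<lambda>u. p u + p' u) \<in> plots ?W"
    proof (rule plot_local[OF W])
      fix u assume u: "u \<in> U"
      obtain A where A: "openin (Euclidean_space n) A" "u \<in> A" "A \<subseteq> U"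
        "(\<forall>x\<in>A. p x = 0) \<or> (\<exists>Y f q. (Y, f) \<in> F \<and> (n, A, q) \<in> plots Y \<and> (\<forall>x\<in>A. p x = f (q x)))"
        using loc[OF p u] by blast
      obtain B where B: "openin (Euclidean_space n) B" "u \<in> B" "B \<subseteq> U"
        "(\<forall>x\<in>B. p' x = 0) \<or> (\<exists>Y f q. (Y, f) \<in> F \<and> (n, B, q) \<in> plots Y \<and> (\<forall>x\<in>B. p' x = f (q x)))"
        using loc[OF p' u] by blast
      \<comment> \<open>On the intersection both local descriptions are available at once.\<close>
      have AB: "openin (Euclidean_space n) (A \<inter> B)" using A(1) B(1) by blast
      have res: "(n, A \<inter> B, p) \<in> plots ?W" "(n, A \<inter> B, p') \<in> plots ?W"
        using plot_restrict[OF W p AB] plot_restrict[OF W p' AB] A(3) by auto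
      consider "\<forall>x\<in>A. p x = 0" | "\<forall>x\<in>B. p' x = 0"
        | Y f q Y' f' q' where "(Y, f) \<in> F" "(n, A, q) \<in> plots Y" "\<forall>x\<in>A. p x = f (q x)"
          "(Y', f') \<in> F" "(n, B, q') \<in> plots Y'" "\<forall>x\<in>B. p' x = f' (q' x)"
        using A(4) B(4) by blast
      then have "(n, A \<inter> B, \<lambda>u. p u + p' u) \<in> plots ?W"
      proof cases
        case 1
        then show ?thesis by (intro plot_cong[OF W res(2)]) auto
      next
        case 2
        then show ?thesis by (intro plot_cong[OF W res(1)]) auto
      next
        case 3
        have "(n, A \<inter> B, q) \<in> plots Y" "(n, A \<inter> B, q') \<in> plots Y'"
          using plot_restrict[OF source[OF 3(1)] 3(2) AB] plot_restrict[OF source[OF 3(4)] 3(5) AB]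
          by auto
        from plot_cong[OF W add[OF 3(1,4) this]] 3(3,6) show ?thesis by auto
      qed
      then show "\<exists>U'. u \<in> U' \<and> U' \<subseteq> U \<and> (n, U', \<lambda>u. p u + p' u) \<in> plots ?W"
        using A B by blast
    qed
  next
    fix n U r p
    assume r: "smooth_fun n U r" and p: "(n, U, p) \<in> plots ?W"
    show "(n, U, \<lambda>u. r u *\<^sub>R p u) \<in> plots ?W"
    proof (rule plot_local[OF W])
      fix u assume u: "u \<in> U"
      obtain A where A: "openin (Euclidean_space n) A" "u \<in> A" "A \<subseteq> U"
        "(\<forall>x\<in>A. p x = 0) \<or> (\<exists>Y f q. (Y, f) \<in> F \<and> (n, A, q) \<in> plots Y \<and> (\<forall>x\<in>A. p x = f (q x)))"
        using loc[OF p u] by blast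
      have rA: "smooth_fun n A r"
        using r C_diff_subset[OF _ A(3)] by (auto simp: smooth_fun_def)
      from A(4) have "(n, A, \<lambda>u. r u *\<^sub>R p u) \<in> plots ?W"
      proof (elim disjE exE conjE)
        assume 0: "\<forall>x\<in>A. p x = 0"
        show ?thesis
          by (rule plot_cong[OF W plot_const[OF W A(1), of 0]]) (use 0 S in \<open>auto intro: subspace_0\<close>)
      next
        fix Y f q assume *: "(Y, f) \<in> F" "(n, A, q) \<in> plots Y" "\<forall>x\<in>A. p x = f (q x)"
        show ?thesis
          by (rule plot_cong[OF W scale[OF *(1) rA *(2)]]) (use *(3) in auto)
      qed
      then show "\<exists>U'. u \<in> U' \<and> U' \<subseteq> U \<and> (n, U', \<lambda>u. r u *\<^sub>R p u) \<in> plots ?W"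
        using A by blast
    qed
  qed
qed

section \<open>Finitely supported functions as a vector space\<close>

lemma lookup_scaleR: "Poly_Mapping.lookup (r *\<^sub>R v) k = r *\<^sub>R Poly_Mapping.lookup v k"
proof -
  have "finite {k. r *\<^sub>R Poly_Mapping.lookup v k \<noteq> 0}"
    by (rule finite_subset[OF _ finite_lookup[of v]]) auto
  then show ?thesis by (simp add: scaleR_poly_mapping_def)
qed

lemma scaleR_single: "r *\<^sub>R Poly_Mapping.single k a = Poly_Mapping.single k (r *\<^sub>R a)"
  by (rule poly_mapping_eqI) (auto simp: lookup_scaleR lookup_single when_def)

lemma lookup_sum_single:
  "finite J \<Longrightarrow> Poly_Mapping.lookup (\<Sum>j\<in>J. Poly_Mapping.single j (w j)) k = (if k \<in> J then w k else 0)"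
  by (simp add: lookup_sum lookup_single when_def)

lemma poly_mapping_sum_single:
  "finite J \<Longrightarrow> Poly_Mapping.keys v \<subseteq> J \<Longrightarrow>
     (\<Sum>j\<in>J. Poly_Mapping.single j (Poly_Mapping.lookup v j)) = v"
  by (rule poly_mapping_eqI) (auto simp: lookup_sum_single in_keys_iff)

section \<open>Coproducts and free diffeological vector spaces\<close>

abbreviation coproduct_points where
  "coproduct_points I V \<equiv>
     {v. Poly_Mapping.keys v \<subseteq> I \<and> (\<forall>i\<in>I. Poly_Mapping.lookup v i \<in> points (V i))}"

abbreviation coproduct_generators where
  "coproduct_generators I V \<equiv>
     {(Pi_diffspace J V, \<lambda>w. \<Sum>j\<in>J. Poly_Mapping.single j (w j)) | J. finite J \<and> J \<subseteq> I}"

context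
  fixes I :: "'i set" and V :: "'i \<Rightarrow> 'a::real_vector diffspace"
  assumes V: "\<And>i. i \<in> I \<Longrightarrow> diffeological_vector_space (V i)"
begin

lemma final_family_coproduct: "final_family (coproduct_points I V) (coproduct_generators I V)"
proof
  fix Y :: "('i \<Rightarrow> 'a) diffspace" and f :: "('i \<Rightarrow> 'a) \<Rightarrow> 'i \<Rightarrow>\<^sub>0 'a"
  assume "(Y, f) \<in> coproduct_generators I V"
  then obtain J where J: "finite J" "J \<subseteq> I" "Y = Pi_diffspace J V"
    "f = (\<lambda>w. \<Sum>j\<in>J. Poly_Mapping.single j (w j))" by auto
  then show "diffeological_space Y"
    using V by (auto intro!: diffeological_Pi dvect_diffeological)
  show "f y \<in> coproduct_points I V" if "y \<in> points Y" for y
    using that J V[THEN dvect_subspace, THEN subspace_0]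
    by (auto simp: Pi_diffspace_def lookup_sum_single in_keys_iff split: if_splits)
qed

lemma coproduct_plot:
  assumes "finite J" "J \<subseteq> I" "openin (Euclidean_space n) U"
    and "\<And>j. j \<in> J \<Longrightarrow> (n, U, w j) \<in> plots (V j)"
  shows "(n, U, \<lambda>u. \<Sum>j\<in>J. Poly_Mapping.single j (w j u)) \<in> plots (coproduct_dvect I V)"
proof -
  have "(n, U, \<lambda>u. restrict (\<lambda>j. w j u) J) \<in> plots (Pi_diffspace J V)"
    using assms V by (intro Pi_plotI dvect_diffeological) auto
  from final_family.generator_plot[OF final_family_coproduct _ this] assms(1,2)
  show ?thesis unfolding coproduct_dvect_def by fastforce
qed

text \<open>Together with \<open>coproduct_plot\<close> this replaces the products by finite
  families of plots on a common domain, on which the vector space operations are easily carried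
  out.\<close>

lemma coproduct_generator_plot_form:
  assumes "(Y, f) \<in> coproduct_generators I V" "(n, U, q) \<in> plots Y"
  shows "\<exists>J w. finite J \<and> J \<subseteq> I \<and> (\<forall>j\<in>J. (n, U, w j) \<in> plots (V j)) \<and>
    (\<forall>u. f (q u) = (\<Sum>j\<in>J. Poly_Mapping.single j (w j u)))"
proof -
  from assms(1) obtain J where J: "finite J" "J \<subseteq> I" "Y = Pi_diffspace J V"
    "f = (\<lambda>w. \<Sum>j\<in>J. Poly_Mapping.single j (w j))" by auto
  show ?thesis
    by (rule exI[of _ J], rule exI[of _ "\<lambda>j u. q u j"]) (use J assms(2) Pi_plotD in auto)
qed

lemma diffeological_vector_space_coproduct: "diffeological_vector_space (coproduct_dvect I V)"
  unfolding coproduct_dvect_def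
proof (rule diffeological_vector_space_final[OF final_family_coproduct])
  note sub = V[THEN dvect_subspace]
  show "subspace (coproduct_points I V)"
  proof (rule subspaceI)
    show "v + w \<in> coproduct_points I V" if "v \<in> coproduct_points I V" "w \<in> coproduct_points I V" for v w
      using that sub[THEN subspace_add] keys_add[of v w] by (auto simp: lookup_add)
    show "r *\<^sub>R v \<in> coproduct_points I V" if "v \<in> coproduct_points I V" for r v
      using that sub[THEN subspace_scale] by (auto simp: lookup_scaleR in_keys_iff)
  qed (use sub[THEN subspace_0] in auto)
  show "\<exists>(Y, f)\<in>coproduct_generators I V. s \<in> f ` points Y"
    if s: "s \<in> coproduct_points I V" "s \<noteq> 0" for s
  proof -
    let ?f = "\<lambda>w. \<Sum>j\<in>Poly_Mapping.keys s. Poly_Mapping.single j (w j)"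
    let ?w = "restrict (Poly_Mapping.lookup s) (Poly_Mapping.keys s)"
    have fw: "?f ?w = s"
      using poly_mapping_sum_single[of "Poly_Mapping.keys s" s] by (simp cong: sum.cong)
    have "?w \<in> points (Pi_diffspace (Poly_Mapping.keys s) V)"
      using s by (auto simp: Pi_diffspace_def)
    then have "s \<in> ?f ` points (Pi_diffspace (Poly_Mapping.keys s) V)"
      by (rule rev_image_eqI) (rule fw[symmetric])
    moreover have "(Pi_diffspace (Poly_Mapping.keys s) V, ?f) \<in> coproduct_generators I V"
      using s by auto
    ultimately show ?thesis
      by (intro bexI[where x = "(Pi_diffspace (Poly_Mapping.keys s) V, ?f)"]) auto
  qed
next
  fix Y Y' :: "('i \<Rightarrow> 'a) diffspace" and f f' :: "('i \<Rightarrow> 'a) \<Rightarrow> 'i \<Rightarrow>\<^sub>0 'a" and n U q q'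
  assume gens: "(Y, f) \<in> coproduct_generators I V" "(Y', f') \<in> coproduct_generators I V"
    and q: "(n, U, q) \<in> plots Y" and q': "(n, U, q') \<in> plots Y'"
  obtain J w where J: "finite J" "J \<subseteq> I" "\<forall>j\<in>J. (n, U, w j) \<in> plots (V j)"
    "\<forall>u. f (q u) = (\<Sum>j\<in>J. Poly_Mapping.single j (w j u))"
    using coproduct_generator_plot_form[OF gens(1) q] by blast
  obtain J' w' where J': "finite J'" "J' \<subseteq> I" "\<forall>j\<in>J'. (n, U, w' j) \<in> plots (V j)"
    "\<forall>u. f' (q' u) = (\<Sum>j\<in>J'. Poly_Mapping.single j (w' j u))"
    using coproduct_generator_plot_form[OF gens(2) q'] by blast
  have U: "openin (Euclidean_space n) U"
    using plot_openin[OF final_family.source[OF final_family_coproduct gens(1)] q] .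
  \<comment> \<open>Both families are extended by zero to the union of their index sets, so that
    they can be added in each summand.\<close>
  define W where "W j u = (if j \<in> J then w j u else 0) + (if j \<in> J' then w' j u else 0)" for j u
  have "(n, U, W j) \<in> plots (V j)" if "j \<in> J \<union> J'" for j
  proof -
    have Vj: "diffeological_vector_space (V j)" using V that J(2) J'(2) by auto
    have "(n, U, \<lambda>u. if j \<in> J then w j u else 0) \<in> plots (V j)"
      "(n, U, \<lambda>u. if j \<in> J' then w' j u else 0) \<in> plots (V j)"
      using J(3) J'(3) dvect_plot_zero[OF Vj U] by (cases "j \<in> J"; cases "j \<in> J'"; simp)+
    from dvect_plot_add[OF Vj this] show ?thesis by (simp add: W_def[abs_def])
  qed
  then have "(n, U, \<lambda>u. \<Sum>j\<in>J \<union> J'. Poly_Mapping.single j (W j u)) \<in> plots (coproduct_dvect I V)"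
    using J J' U by (intro coproduct_plot) auto
  moreover have "(\<Sum>j\<in>J \<union> J'. Poly_Mapping.single j (W j u)) = f (q u) + f' (q' u)" for u
    using J(1,4) J'(1,4) by (intro poly_mapping_eqI) (auto simp: lookup_sum_single lookup_add W_def)
  ultimately show "(n, U, \<lambda>u. f (q u) + f' (q' u))
      \<in> plots (final_diffspace (coproduct_points I V) (coproduct_generators I V))"
    by (simp add: coproduct_dvect_def)
next
  fix Y :: "('i \<Rightarrow> 'a) diffspace" and f :: "('i \<Rightarrow> 'a) \<Rightarrow> 'i \<Rightarrow>\<^sub>0 'a" and n U r q
  assume gen: "(Y, f) \<in> coproduct_generators I V" and r: "smooth_fun n U r" and q: "(n, U, q) \<in> plots Y"
  obtain J w where J: "finite J" "J \<subseteq> I" "\<forall>j\<in>J. (n, U, w j) \<in> plots (V j)"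
    "\<forall>u. f (q u) = (\<Sum>j\<in>J. Poly_Mapping.single j (w j u))"
    using coproduct_generator_plot_form[OF gen q] by blast
  have "(n, U, \<lambda>u. \<Sum>j\<in>J. Poly_Mapping.single j (r u *\<^sub>R w j u)) \<in> plots (coproduct_dvect I V)"
    using J V r plot_openin[OF final_family.source[OF final_family_coproduct gen] q]
    by (intro coproduct_plot dvect_plot_scale) auto
  then show "(n, U, \<lambda>u. r u *\<^sub>R f (q u))
      \<in> plots (final_diffspace (coproduct_points I V) (coproduct_generators I V))"
    using J(4) by (simp add: coproduct_dvect_def scaleR_sum_right scaleR_single)
qed

end

section \<open>Free diffeological vector spaces\<close>

abbreviation free_generators ::
    "'x diffspace \<Rightarrow>
      ((nat \<Rightarrow> real \<times> pt) diffspace \<times>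
        ((nat \<Rightarrow> real \<times> pt) \<Rightarrow> ('x \<Rightarrow>\<^sub>0 real))) set" where
  "free_generators X \<equiv>
       {(Pi_diffspace {..<n} (\<lambda>i. prod_diffspace real_diffspace (open_diffspace (m i) (U i))),
         \<lambda>w. \<Sum>i<n. Poly_Mapping.single (p i (snd (w i))) (fst (w i))) | (n :: nat) m U p.
        1 \<le> n \<and> (\<forall>i<n. (m i, U i, p i) \<in> plots X)}"

lemma sum_lessThan_add:
  fixes f :: "nat \<Rightarrow> 'a::comm_monoid_add"
  shows "(\<Sum>i<a + b. f i) = (\<Sum>i<a. f i) + (\<Sum>i<b. f (a + i))"
  by (induction b) (auto simp: add.assoc)

context
  fixes X :: "'x diffspace"
  assumes X: "diffeological_space X"
begin

lemma final_family_free: "final_family {v. Poly_Mapping.keys v \<subseteq> points X} (free_generators X)"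
proof
  fix Y :: "(nat \<Rightarrow> real \<times> pt) diffspace" and f :: "(nat \<Rightarrow> real \<times> pt) \<Rightarrow> 'x \<Rightarrow>\<^sub>0 real"
  assume "(Y, f) \<in> free_generators X"
  then obtain N m U p where
    Y: "Y = Pi_diffspace {..<N} (\<lambda>i. prod_diffspace real_diffspace (open_diffspace (m i) (U i)))"
    and f: "f = (\<lambda>w. \<Sum>i<N. Poly_Mapping.single (p i (snd (w i))) (fst (w i)))"
    and p: "\<And>i. i < N \<Longrightarrow> (m i, U i, p i) \<in> plots X"
    by auto
  show "diffeological_space Y"
    unfolding Y using plot_openin[OF X p]
    by (intro diffeological_Pi diffeological_prod diffeological_real diffeological_open) auto
  show "f y \<in> {v. Poly_Mapping.keys v \<subseteq> points X}" if y: "y \<in> points Y" for y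
  proof -
    have "snd (y i) \<in> U i" if "i < N" for i
      using y that by (auto simp: Y Pi_diffspace_def prod_diffspace_def open_diffspace_def PiE_def Pi_def mem_Times_iff)
    then have "p i (snd (y i)) \<in> points X" if "i < N" for i
      using plot_in_points[OF X p[OF that]] that by blast
    then have "Poly_Mapping.keys (Poly_Mapping.single (p i (snd (y i))) (fst (y i))) \<subseteq> points X"
      if "i < N" for i using that by simp
    then show ?thesis unfolding f
      using keys_sum[of "\<lambda>i. Poly_Mapping.single (p i (snd (y i))) (fst (y i))" "{..<N}"] by fastforce
  qed
qed

text \<open>Take the generator all of whose parametrisations \<open>y i\<close> have the same domain
  \<open>U\<close>, and precompose it with the diagonal map whose components are
  \<open>(r i u, u)\<close>.\<close>

lemma free_plot:
  fixes N :: nat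
  assumes U: "openin (Euclidean_space n) U" and N: "1 \<le> N"
    and r: "\<And>i. i < N \<Longrightarrow> smooth_fun n U (r i)" and y: "\<And>i. i < N \<Longrightarrow> (n, U, y i) \<in> plots X"
  shows "(n, U, \<lambda>u. \<Sum>i<N. Poly_Mapping.single (y i u) (r i u)) \<in> plots (free_dvect X)"
proof -
  let ?Y = "Pi_diffspace {..<N} (\<lambda>i. prod_diffspace real_diffspace (open_diffspace n U))"
  let ?f = "\<lambda>w :: nat \<Rightarrow> real \<times> pt. \<Sum>i<N. Poly_Mapping.single (y i (snd (w i))) (fst (w i))"
  have gen: "(?Y, ?f) \<in> free_generators X"
    using N y by (auto intro!: exI[of _ N] exI[of _ "\<lambda>_. n"] exI[of _ "\<lambda>_. U"] exI[of _ y])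
  have "(n, U, \<lambda>u. restrict (\<lambda>i. (r i u, u)) {..<N}) \<in> plots ?Y"
    using U r smooth_open_map_id[OF U U]
    by (intro Pi_plotI diffeological_prod diffeological_real diffeological_open)
      (auto simp: prod_diffspace_def real_diffspace_def open_diffspace_def comp_def)
  from final_family.generator_plot[OF final_family_free gen this]
  have "(n, U, \<lambda>u. ?f (restrict (\<lambda>i. (r i u, u)) {..<N})) \<in> plots (free_dvect X)"
    by (simp only: free_dvect_def)
  moreover have "?f (restrict (\<lambda>i. (r i u, u)) {..<N}) = (\<Sum>i<N. Poly_Mapping.single (y i u) (r i u))" for u
    by (intro sum.cong) auto
  ultimately show ?thesis by (simp only:)
qed

text \<open>The converse of \<open>free_plot\<close>: a plot of the source reparametrises every
  \<open>p i\<close>, which brings all of them to one common domain.\<close>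

lemma free_generator_plot_form:
  assumes "(Y, f) \<in> free_generators X" "(n, U, q) \<in> plots Y"
  shows "\<exists>N\<ge>1::nat. \<exists>r y. (\<forall>i<N. smooth_fun n U (r i)) \<and> (\<forall>i<N. (n, U, y i) \<in> plots X) \<and>
    (\<forall>u. f (q u) = (\<Sum>i<N. Poly_Mapping.single (y i u) (r i u)))"
proof -
  from assms(1) obtain N :: nat and m T p where
    Y: "Y = Pi_diffspace {..<N} (\<lambda>i. prod_diffspace real_diffspace (open_diffspace (m i) (T i)))"
    and f: "f = (\<lambda>w. \<Sum>i<N. Poly_Mapping.single (p i (snd (w i))) (fst (w i)))"
    and N: "1 \<le> N" and p: "\<And>i. i < N \<Longrightarrow> (m i, T i, p i) \<in> plots X"
    by auto
  have "smooth_fun n U (\<lambda>u. fst (q u i)) \<and> (n, U, \<lambda>u. p i (snd (q u i))) \<in> plots X" if "i < N" for i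
  proof -
    have "(n, U, \<lambda>u. q u i) \<in> plots (prod_diffspace real_diffspace (open_diffspace (m i) (T i)))"
      using Pi_plotD[OF assms(2)[unfolded Y], of i] that by simp
    then have "smooth_fun n U (\<lambda>u. fst (q u i))" "smooth_open_map n U (m i) (T i) (\<lambda>u. snd (q u i))"
      by (simp_all add: prod_diffspace_def real_diffspace_def open_diffspace_def comp_def)
    with plot_compose[OF X p[OF that]] show ?thesis by (auto simp: comp_def)
  qed
  then show ?thesis
    by (intro exI[of _ N] conjI N exI[of _ "\<lambda>i u. fst (q u i)"] exI[of _ "\<lambda>i u. p i (snd (q u i))"])
      (auto simp: f)
qed

lemma diffeological_vector_space_free: "diffeological_vector_space (free_dvect X)"
  unfolding free_dvect_def
proof (rule diffeological_vector_space_final[OF final_family_free])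
  show "subspace {v :: 'x \<Rightarrow>\<^sub>0 real. Poly_Mapping.keys v \<subseteq> points X}"
  proof (rule subspaceI)
    show "v + w \<in> {v :: 'x \<Rightarrow>\<^sub>0 real. Poly_Mapping.keys v \<subseteq> points X}"
      if "v \<in> {v. Poly_Mapping.keys v \<subseteq> points X}" "w \<in> {v. Poly_Mapping.keys v \<subseteq> points X}" for v w
      using that keys_add[of v w] by auto
  qed (auto simp: lookup_scaleR in_keys_iff)
  show "\<exists>(Y, f)\<in>free_generators X. s \<in> f ` points Y"
    if s: "s \<in> {v. Poly_Mapping.keys v \<subseteq> points X}" "s \<noteq> 0" for s
  proof -
    \<comment> \<open>One term for each basis element in the support; \<open>s \<noteq> 0\<close>
      gives the required \<open>1 \<le> N\<close>.\<close>
    define N where "N = card (Poly_Mapping.keys s)"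
    obtain h where h: "bij_betw h {..<N} (Poly_Mapping.keys s)"
      using ex_bij_betw_nat_finite[of "Poly_Mapping.keys s"] by (auto simp: N_def atLeast0LessThan)
    \<comment> \<open>Each basis element is reached by a constant plot on the one-point space
      R^0.\<close>
    let ?T = "topspace (Euclidean_space 0)"
    let ?Y = "Pi_diffspace {..<N} (\<lambda>i. prod_diffspace real_diffspace (open_diffspace 0 ?T))"
    let ?f = "\<lambda>w :: nat \<Rightarrow> real \<times> pt. \<Sum>i<N. Poly_Mapping.single (h i) (fst (w i))"
    let ?w = "restrict (\<lambda>i. (Poly_Mapping.lookup s (h i), \<lambda>_. 0)) {..<N}"
    have "N \<ge> 1" using s(2) by (simp add: N_def Suc_le_eq card_gt_0_iff)
    moreover have "(0, ?T, \<lambda>_. h i) \<in> plots X" if "i < N" for i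
      using plot_const[OF X, of 0 ?T "h i"] h s that by (auto simp: bij_betw_def)
    ultimately have gen: "(?Y, ?f) \<in> free_generators X"
      by (auto intro!: exI[of _ N] exI[of _ "\<lambda>_. 0"] exI[of _ "\<lambda>_. ?T"] exI[of _ "\<lambda>i _. h i"])
    have "?f ?w = (\<Sum>i<N. Poly_Mapping.single (h i) (Poly_Mapping.lookup s (h i)))"
      by (intro sum.cong) auto
    also have "\<dots> = (\<Sum>x\<in>Poly_Mapping.keys s. Poly_Mapping.single x (Poly_Mapping.lookup s x))"
      by (rule sum.reindex_bij_betw[OF h])
    also have "\<dots> = s" by (simp add: poly_mapping_sum_single)
    finally have fw: "?f ?w = s" .
    have "?w \<in> points ?Y"
      by (auto simp: Pi_diffspace_def prod_diffspace_def real_diffspace_def open_diffspace_def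
          topspace_Euclidean_space)
    then have "s \<in> ?f ` points ?Y" by (rule rev_image_eqI) (rule fw[symmetric])
    with gen show ?thesis by (intro bexI[where x = "(?Y, ?f)"]) auto
  qed
next
  fix Y Y' :: "(nat \<Rightarrow> real \<times> pt) diffspace" and f f' :: "_ \<Rightarrow> 'x \<Rightarrow>\<^sub>0 real" and n U q q'
  assume gens: "(Y, f) \<in> free_generators X" "(Y', f') \<in> free_generators X"
    and q: "(n, U, q) \<in> plots Y" and q': "(n, U, q') \<in> plots Y'"
  obtain N :: nat and r y where N: "1 \<le> N" "\<forall>i<N. smooth_fun n U (r i)"
    "\<forall>i<N. (n, U, y i) \<in> plots X"
    "\<forall>u. f (q u) = (\<Sum>i<N. Poly_Mapping.single (y i u) (r i u))"
    using free_generator_plot_form[OF gens(1) q] by blast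
  obtain N' :: nat and r' y' where N': "1 \<le> N'" "\<forall>i<N'. smooth_fun n U (r' i)"
    "\<forall>i<N'. (n, U, y' i) \<in> plots X"
    "\<forall>u. f' (q' u) = (\<Sum>i<N'. Poly_Mapping.single (y' i u) (r' i u))"
    using free_generator_plot_form[OF gens(2) q'] by blast
  \<comment> \<open>The two sums are concatenated, the terms of the second being shifted by
    \<open>N\<close>.\<close>
  let ?R = "\<lambda>i. if i < N then r i else r' (i - N)"
  let ?y = "\<lambda>i. if i < N then y i else y' (i - N)"
  have "(n, U, \<lambda>u. \<Sum>i<N + N'. Poly_Mapping.single (?y i u) (?R i u)) \<in> plots (free_dvect X)"
    using N(1-3) N'(2,3) plot_openin[OF final_family.source[OF final_family_free gens(1)] q]
    by (intro free_plot) auto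
  then show "(n, U, \<lambda>u. f (q u) + f' (q' u))
      \<in> plots (final_diffspace {v. Poly_Mapping.keys v \<subseteq> points X} (free_generators X))"
    using N(4) N'(4) by (simp add: free_dvect_def sum_lessThan_add)
next
  fix Y :: "(nat \<Rightarrow> real \<times> pt) diffspace" and f :: "_ \<Rightarrow> 'x \<Rightarrow>\<^sub>0 real" and n U r q
  assume gen: "(Y, f) \<in> free_generators X" and r: "smooth_fun n U r" and q: "(n, U, q) \<in> plots Y"
  obtain N :: nat and s y where N: "1 \<le> N" "\<forall>i<N. smooth_fun n U (s i)"
    "\<forall>i<N. (n, U, y i) \<in> plots X"
    "\<forall>u. f (q u) = (\<Sum>i<N. Poly_Mapping.single (y i u) (s i u))"
    using free_generator_plot_form[OF gen q] by blast
  have U: "openin (Euclidean_space n) U"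
    using plot_openin[OF final_family.source[OF final_family_free gen] q] .
  have "(n, U, \<lambda>u. \<Sum>i<N. Poly_Mapping.single (y i u) (r u * s i u)) \<in> plots (free_dvect X)"
    using N U r by (intro free_plot smooth_fun_mult) auto
  then show "(n, U, \<lambda>u. r u *\<^sub>R f (q u))
      \<in> plots (final_diffspace {v. Poly_Mapping.keys v \<subseteq> points X} (free_generators X))"
    using N(4) by (simp add: free_dvect_def scaleR_sum_right scaleR_single)
qed

end

section \<open>Universal properties\<close>

text \<open>One formula serves both universal properties: for a direct sum, \<open>\<phi> i\<close>
  is the map on the summand \<open>i\<close>; for a free space, \<open>\<phi> x\<close> sends a
  scalar to its multiple of the image of \<open>x\<close>.\<close>

definition linear_extension :: "('x \<Rightarrow> 'c \<Rightarrow> 'b) \<Rightarrow> ('x \<Rightarrow>\<^sub>0 'c::zero) \<Rightarrow> 'b::comm_monoid_add" where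
  "linear_extension \<phi> v = (\<Sum>x\<in>Poly_Mapping.keys v. \<phi> x (Poly_Mapping.lookup v x))"

context
  fixes \<phi> :: "'x \<Rightarrow> 'c::real_vector \<Rightarrow> 'b::real_vector"
  assumes \<phi>: "\<And>x. linear (\<phi> x)"
begin

text \<open>Linear maps send 0 to 0, so points outside the support contribute nothing. Additivity
  follows by summing over the union of two supports.\<close>

lemma linear_extension_superset:
  assumes "finite A" "Poly_Mapping.keys v \<subseteq> A"
  shows "linear_extension \<phi> v = (\<Sum>x\<in>A. \<phi> x (Poly_Mapping.lookup v x))"
  unfolding linear_extension_def
  by (rule sum.mono_neutral_left) (use assms linear_0[OF \<phi>] in \<open>auto simp: in_keys_iff\<close>)

lemma linear_linear_extension: "linear (linear_extension \<phi>)"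
proof (rule linearI)
  fix v w :: "'x \<Rightarrow>\<^sub>0 'c" and r :: real
  let ?A = "Poly_Mapping.keys v \<union> Poly_Mapping.keys w"
  have "linear_extension \<phi> (v + w) = (\<Sum>x\<in>?A. \<phi> x (Poly_Mapping.lookup (v + w) x))"
    by (rule linear_extension_superset) (auto simp: keys_add)
  then show "linear_extension \<phi> (v + w) = linear_extension \<phi> v + linear_extension \<phi> w"
    by (simp add: linear_extension_superset[of ?A] lookup_add linear_add[OF \<phi>] sum.distrib)
  have "linear_extension \<phi> (r *\<^sub>R v) = (\<Sum>x\<in>Poly_Mapping.keys v. \<phi> x (Poly_Mapping.lookup (r *\<^sub>R v) x))"
    by (rule linear_extension_superset) (auto simp: in_keys_iff lookup_scaleR)
  then show "linear_extension \<phi> (r *\<^sub>R v) = r *\<^sub>R linear_extension \<phi> v"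
    by (simp add: linear_extension_def lookup_scaleR linear_scale[OF \<phi>] scaleR_sum_right)
qed

lemma linear_extension_single: "linear_extension \<phi> (Poly_Mapping.single x a) = \<phi> x a"
  using linear_extension_superset[of "{x}" "Poly_Mapping.single x a"] by auto

lemma linear_extension_sum_single:
  "linear_extension \<phi> (\<Sum>j\<in>J. Poly_Mapping.single (y j) (w j)) = (\<Sum>j\<in>J. \<phi> (y j) (w j))"
  by (simp add: linear_sum[OF linear_linear_extension] linear_extension_single)

end

text \<open>On a generator plot the map is a finite sum of plots \<open>\<phi> j (w j u)\<close> of
  \<open>Z\<close>. Linearity is asked for every index, so that the extension is linear on the whole
  type.\<close>

lemma smooth_map_coproduct:
  fixes V :: "'i \<Rightarrow> 'a::real_vector diffspace" and Z :: "'b::real_vector diffspace"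
  assumes V: "\<And>i. i \<in> I \<Longrightarrow> diffeological_vector_space (V i)" and Z: "diffeological_vector_space Z"
    and lin: "\<And>i. linear (\<phi> i)" and sm: "\<And>i. i \<in> I \<Longrightarrow> smooth_map (V i) Z (\<phi> i)"
  shows "smooth_map (coproduct_dvect I V) Z (linear_extension \<phi>)"
proof -
  have fam: "final_family (coproduct_points I V) (coproduct_generators I V)"
    using V by (rule final_family_coproduct)
  show ?thesis
    unfolding coproduct_dvect_def
  proof (rule final_family.smooth_map_final[OF fam dvect_diffeological[OF Z]])
    show sub: "linear_extension \<phi> ` coproduct_points I V \<subseteq> points Z"
      using sm by (fastforce simp: linear_extension_def smooth_map_def image_subset_iff
          intro!: subspace_sum[OF dvect_subspace[OF Z]])
    fix Y :: "('i \<Rightarrow> 'a) diffspace" and f :: "('i \<Rightarrow> 'a) \<Rightarrow> 'i \<Rightarrow>\<^sub>0 'a"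
    assume gen: "(Y, f) \<in> coproduct_generators I V"
    have "(n, U, \<lambda>u. linear_extension \<phi> (f (q u))) \<in> plots Z" if q: "(n, U, q) \<in> plots Y" for n U q
    proof -
      obtain J w where J: "finite J" "J \<subseteq> I" "\<forall>j\<in>J. (n, U, w j) \<in> plots (V j)"
        "\<forall>u. f (q u) = (\<Sum>j\<in>J. Poly_Mapping.single j (w j u))"
        using coproduct_generator_plot_form[OF V gen q] by blast
      have "(n, U, \<lambda>u. \<Sum>j\<in>J. \<phi> j (w j u)) \<in> plots Z"
        by (rule dvect_plot_sum[OF Z plot_openin[OF final_family.source[OF fam gen] q]])
          (rule smooth_map_plot[OF sm], use J in auto)
      then show ?thesis using J(4) by (simp add: linear_extension_sum_single[of \<phi>, OF lin])
    qed
    moreover have "linear_extension \<phi> (f y) \<in> points Z" if "y \<in> points Y" for y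
      using final_family.into[OF fam gen that] sub by blast
    ultimately show "smooth_map Y Z (\<lambda>y. linear_extension \<phi> (f y))"
      by (auto simp: smooth_map_def comp_def)
  qed
qed

lemma linear_scaleR_vector: "linear (\<lambda>r::real. r *\<^sub>R v)"
  by (simp add: linear_iff scaleR_add_left)

lemma smooth_map_free:
  fixes X :: "'x diffspace" and Z :: "'b::real_vector diffspace"
  assumes X: "diffeological_space X" and Z: "diffeological_vector_space Z" and p: "smooth_map X Z p"
  shows "smooth_map (free_dvect X) Z (linear_extension (\<lambda>x r. r *\<^sub>R p x))"
  unfolding free_dvect_def
proof (rule final_family.smooth_map_final[OF final_family_free[OF X] dvect_diffeological[OF Z]])
  let ?e = "linear_extension (\<lambda>x r. r *\<^sub>R p x)"
  show sub: "?e ` {v. Poly_Mapping.keys v \<subseteq> points X} \<subseteq> points Z"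
    using p by (auto simp: linear_extension_def smooth_map_def
        intro!: subspace_sum[OF dvect_subspace[OF Z]] subspace_scale[OF dvect_subspace[OF Z]])
  fix Y :: "(nat \<Rightarrow> real \<times> pt) diffspace" and f :: "(nat \<Rightarrow> real \<times> pt) \<Rightarrow> 'x \<Rightarrow>\<^sub>0 real"
  assume gen: "(Y, f) \<in> free_generators X"
  note fam = final_family_free[OF X]
  have "(n, U, \<lambda>u. ?e (f (q u))) \<in> plots Z" if q: "(n, U, q) \<in> plots Y" for n U q
  proof -
    obtain N :: nat and r y where N: "\<forall>i<N. smooth_fun n U (r i)" "\<forall>i<N. (n, U, y i) \<in> plots X"
      "\<forall>u. f (q u) = (\<Sum>i<N. Poly_Mapping.single (y i u) (r i u))"
      using free_generator_plot_form[OF X gen q] by blast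
    have "(n, U, \<lambda>u. \<Sum>i<N. r i u *\<^sub>R p (y i u)) \<in> plots Z"
      by (rule dvect_plot_sum[OF Z plot_openin[OF final_family.source[OF fam gen] q]])
        (use N smooth_map_plot[OF p] in \<open>auto intro!: dvect_plot_scale[OF Z]\<close>)
    then show ?thesis
      using N(3) by (simp add: linear_extension_sum_single[of "\<lambda>x r. r *\<^sub>R p x", OF linear_scaleR_vector])
  qed
  moreover have "?e (f y) \<in> points Z" if "y \<in> points Y" for y
    using final_family.into[OF fam gen that] sub by blast
  ultimately show "smooth_map Y Z (\<lambda>y. ?e (f y))"
    by (auto simp: smooth_map_def comp_def)
qed

text \<open>The plots of an open set are the smooth maps into it, so smoothness of \<open>p\<close>
  is the reparametrisation axiom.\<close>

lemma smooth_map_open_plot: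
  assumes "diffeological_space X" "(n, U, p) \<in> plots X"
  shows "smooth_map (open_diffspace n U) X p"
  using plot_compose[OF assms] plot_in_points[OF assms]
  by (auto simp: smooth_map_def open_diffspace_def)

section \<open>Direct summands\<close>

lemma smooth_linear_linear: "linear f \<Longrightarrow> smooth_map V W f \<Longrightarrow> smooth_linear V W f"
  by (simp add: smooth_linear_def linear_add linear_scale)

lemma smooth_linear_compose:
  assumes "smooth_linear U V f" "smooth_linear V W g"
  shows "smooth_linear U W (\<lambda>x. g (f x))"
  using assms by (auto simp: smooth_linear_def smooth_map_def comp_def image_subset_iff)

lemma smooth_linear_points: "smooth_linear V W f \<Longrightarrow> x \<in> points V \<Longrightarrow> f x \<in> points W"
  by (auto simp: smooth_linear_def smooth_map_def)

lemma smooth_linear_plot: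
  "smooth_linear V W f \<Longrightarrow> (n, U, p) \<in> plots V \<Longrightarrow> (n, U, \<lambda>u. f (p u)) \<in> plots W"
  by (auto simp: smooth_linear_def smooth_map_plot)

lemma dvect_plot_minus:
  assumes V: "diffeological_vector_space V" and "(n, U, p) \<in> plots V" "(n, U, q) \<in> plots V"
  shows "(n, U, \<lambda>u. p u - q u) \<in> plots V"
  using dvect_plot_add[OF V assms(2) dvect_plot_scale[OF V smooth_fun_const[of n U "-1"] assms(3)]]
  by simp

text \<open>The kernel with its subspace diffeology.\<close>

definition kernel_diffspace :: "'a diffspace \<Rightarrow> ('a \<Rightarrow> 'b::zero) \<Rightarrow> 'a diffspace" where
  "kernel_diffspace W f = \<lparr>points = {w \<in> points W. f w = 0},
     plots = {(n, U, p). (n, U, p) \<in> plots W \<and> (\<forall>u\<in>U. f (p u) = 0)}\<rparr>"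

lemma diffeological_vector_space_kernel:
  assumes W: "diffeological_vector_space W" and f: "smooth_linear W V f"
  shows "diffeological_vector_space (kernel_diffspace W f)"
proof -
  note dW = dvect_diffeological[OF W] and sW = dvect_subspace[OF W]
  have f_add: "f (x + y) = f x + f y" if "x \<in> points W" "y \<in> points W" for x y
    using f that by (simp add: smooth_linear_def)
  have f_scale: "f (r *\<^sub>R x) = r *\<^sub>R f x" if "x \<in> points W" for r x
    using f that by (simp add: smooth_linear_def)
  have f0: "f 0 = 0" using f_scale[of 0 0] subspace_0[OF sW] by simp
  show ?thesis
  proof (rule diffeological_vector_spaceI)
    show "diffeological_space (kernel_diffspace W f)"
    proof (rule diffeological_spaceI)
      show "(n, U, q) \<in> plots (kernel_diffspace W f)"
        if "(n, U, p) \<in> plots (kernel_diffspace W f)" "\<And>u. u \<in> U \<Longrightarrow> p u = q u" for n U p q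
        using that plot_cong[OF dW, of n U p q] by (auto simp: kernel_diffspace_def)
      show "(m, T, p \<circ> g) \<in> plots (kernel_diffspace W f)"
        if "(n, U, p) \<in> plots (kernel_diffspace W f)" "smooth_open_map m T n U g" for n U p m T g
        using that plot_compose[OF dW, of n U p m T g]
        by (auto simp: kernel_diffspace_def smooth_open_map_def)
      show "(n, \<Union>\<U>, p) \<in> plots (kernel_diffspace W f)"
        if "\<And>U. U \<in> \<U> \<Longrightarrow> (n, U, p) \<in> plots (kernel_diffspace W f)" for n \<U> p
        using that plot_Union[OF dW, of \<U> n p] by (auto simp: kernel_diffspace_def)
    qed (use plot_openin[OF dW] plot_in_points[OF dW] plot_const[OF dW] in
        \<open>auto simp: kernel_diffspace_def\<close>)
    show "subspace (points (kernel_diffspace W f))"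
      using f_add f_scale f0 sW
      by (auto simp: kernel_diffspace_def intro!: subspaceI intro: subspace_0 subspace_add subspace_scale)
  next
    show "(n, U, \<lambda>u. p u + q u) \<in> plots (kernel_diffspace W f)"
      if "(n, U, p) \<in> plots (kernel_diffspace W f)" "(n, U, q) \<in> plots (kernel_diffspace W f)" for n U p q
      using that dvect_plot_add[OF W, of n U p q] f_add plot_in_points[OF dW]
      by (auto simp: kernel_diffspace_def)
    show "(n, U, \<lambda>u. r u *\<^sub>R p u) \<in> plots (kernel_diffspace W f)"
      if "smooth_fun n U r" "(n, U, p) \<in> plots (kernel_diffspace W f)" for n U r p
      using that dvect_plot_scale[OF W, of n U r p] f_scale plot_in_points[OF dW]
      by (auto simp: kernel_diffspace_def)
  qed
qed

text \<open>Every \<open>w\<close> is the sum of \<open>h (f w)\<close> and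
  \<open>w - h (f w)\<close>; the second part is killed by \<open>f\<close> because \<open>h\<close>
  is a section. Both parts depend smoothly on \<open>w\<close>, so this algebraic splitting is an
  isomorphism in DVect.\<close>

lemma smooth_direct_summandI:
  fixes V :: "'a::real_vector diffspace" and W :: "'b::real_vector diffspace"
  assumes V: "diffeological_vector_space V" and W: "diffeological_vector_space W"
    and f: "smooth_linear W V f" and h: "smooth_linear V W h" and fh: "\<And>x. x \<in> points V \<Longrightarrow> f (h x) = x"
  shows "smooth_direct_summand V W"
proof -
  let ?X = "kernel_diffspace W f"
  note sW = dvect_subspace[OF W]
  note W_closed = subspace_add[OF sW] subspace_diff[OF sW] subspace_scale[OF sW]
  note fp = smooth_linear_points[OF f] and hp = smooth_linear_points[OF h]
  have f_add: "f (x + y) = f x + f y" if "x \<in> points W" "y \<in> points W" for x y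
    using f that by (simp add: smooth_linear_def)
  have f_scale: "f (r *\<^sub>R x) = r *\<^sub>R f x" if "x \<in> points W" for r x
    using f that by (simp add: smooth_linear_def)
  have h_add: "h (x + y) = h x + h y" if "x \<in> points V" "y \<in> points V" for x y
    using h that by (simp add: smooth_linear_def)
  have h_scale: "h (r *\<^sub>R x) = r *\<^sub>R h x" if "x \<in> points V" for r x
    using h that by (simp add: smooth_linear_def)
  have f_diff: "f (x - y) = f x - f y" if "x \<in> points W" "y \<in> points W" for x y
    using f_add[of "x - y" y] that W_closed by (simp add: algebra_simps)
  let ?\<phi> = "\<lambda>w. (f w, w - h (f w))" and ?\<psi> = "\<lambda>(v, x). h v + x"
  have "smooth_map W (prod_diffspace V ?X) ?\<phi>"
    unfolding smooth_map_def
  proof (intro conjI allI impI)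
    show "?\<phi> ` points W \<subseteq> points (prod_diffspace V ?X)"
      using fp hp fh f_diff W_closed by (auto simp: prod_diffspace_def kernel_diffspace_def)
    fix n U p assume p: "(n, U, p) \<in> plots W"
    have 1: "(n, U, \<lambda>u. f (p u)) \<in> plots V" using smooth_linear_plot[OF f p] .
    have 2: "(n, U, \<lambda>u. p u - h (f (p u))) \<in> plots W"
      by (rule dvect_plot_minus[OF W p smooth_linear_plot[OF h 1]])
    show "(n, U, ?\<phi> \<circ> p) \<in> plots (prod_diffspace V ?X)"
      using 1 2 fp hp fh f_diff plot_in_points[OF dvect_diffeological[OF W] p]
      by (auto simp: prod_diffspace_def kernel_diffspace_def comp_def)
  qed
  then have \<phi>: "smooth_linear W (prod_diffspace V ?X) ?\<phi>"
    using f_add f_scale h_add h_scale fp by (auto simp: smooth_linear_def algebra_simps)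
  have "smooth_map (prod_diffspace V ?X) W ?\<psi>"
    unfolding smooth_map_def
  proof (intro conjI allI impI)
    show "?\<psi> ` points (prod_diffspace V ?X) \<subseteq> points W"
      using hp W_closed by (auto simp: prod_diffspace_def kernel_diffspace_def)
    fix n U p assume p: "(n, U, p) \<in> plots (prod_diffspace V ?X)"
    then have "(n, U, \<lambda>u. h (fst (p u)) + snd (p u)) \<in> plots W"
      by (intro dvect_plot_add[OF W] smooth_linear_plot[OF h])
        (auto simp: prod_diffspace_def kernel_diffspace_def comp_def)
    then show "(n, U, ?\<psi> \<circ> p) \<in> plots W" by (simp add: comp_def case_prod_beta)
  qed
  then have \<psi>: "smooth_linear (prod_diffspace V ?X) W ?\<psi>"
    using h_add h_scale by (auto simp: smooth_linear_def prod_diffspace_def algebra_simps)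
  have "?\<psi> (?\<phi> w) = w" for w by simp
  moreover have "?\<phi> (?\<psi> z) = z" if "z \<in> points (prod_diffspace V ?X)" for z
    using that f_add fh hp by (auto simp: prod_diffspace_def kernel_diffspace_def)
  ultimately have "dvect_isomorphic W (prod_diffspace V ?X)"
    unfolding dvect_isomorphic_def using \<phi> \<psi> by (intro exI[of _ ?\<phi>] exI[of _ ?\<psi>]) blast
  then show ?thesis
    unfolding smooth_direct_summand_def using diffeological_vector_space_kernel[OF W f] by blast
qed

section \<open>Transport along injective linear maps\<close>

definition transport_diffspace :: "('a \<Rightarrow> 'b) \<Rightarrow> 'a diffspace \<Rightarrow> 'b diffspace" where
  "transport_diffspace e V = \<lparr>points = e ` points V,
     plots = {(n, U, p). p ` U \<subseteq> e ` points V \<and> (n, U, \<lambda>u. inv_into (points V) e (p u)) \<in> plots V}\<rparr>"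

context
  fixes e :: "'a::real_vector \<Rightarrow> 'b::real_vector" and V :: "'a diffspace"
  assumes e: "linear e" and inj: "inj_on e (points V)" and V: "diffeological_vector_space V"
begin

lemma smooth_linear_transport: "smooth_linear V (transport_diffspace e V) e"
proof (rule smooth_linear_linear[OF e])
  note dV = dvect_diffeological[OF V]
  show "smooth_map V (transport_diffspace e V) e"
    unfolding smooth_map_def
  proof (intro conjI allI impI)
    fix n U p assume p: "(n, U, p) \<in> plots V"
    have "(n, U, \<lambda>u. inv_into (points V) e (e (p u))) \<in> plots V"
      by (rule plot_cong[OF dV p]) (use inj plot_in_points[OF dV p] in simp)
    then show "(n, U, e \<circ> p) \<in> plots (transport_diffspace e V)"
      using plot_in_points[OF dV p] by (auto simp: transport_diffspace_def)
  qed (auto simp: transport_diffspace_def)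
qed

lemma inv_transport_add:
  assumes "x \<in> e ` points V" "y \<in> e ` points V"
  shows "inv_into (points V) e (x + y) = inv_into (points V) e x + inv_into (points V) e y"
  using assms inj subspace_add[OF dvect_subspace[OF V]] inv_into_f_f[OF inj]
  by (auto simp flip: linear_add[OF e])

lemma inv_transport_scale:
  assumes "x \<in> e ` points V"
  shows "inv_into (points V) e (r *\<^sub>R x) = r *\<^sub>R inv_into (points V) e x"
  using assms inj subspace_scale[OF dvect_subspace[OF V]] inv_into_f_f[OF inj]
  by (auto simp flip: linear_scale[OF e])

lemma smooth_linear_inv_transport:
  "smooth_linear (transport_diffspace e V) V (inv_into (points V) e)"
  using inv_transport_add inv_transport_scale inv_into_into[of _ e "points V"]
  by (auto simp: smooth_linear_def smooth_map_def transport_diffspace_def comp_def)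

lemma diffeological_vector_space_transport: "diffeological_vector_space (transport_diffspace e V)"
proof (rule diffeological_vector_spaceI)
  note dV = dvect_diffeological[OF V]
  let ?T = "transport_diffspace e V" and ?g = "inv_into (points V) e"
  show "diffeological_space ?T"
  proof (rule diffeological_spaceI)
    show "(n, U, q) \<in> plots ?T" if "(n, U, p) \<in> plots ?T" "\<And>u. u \<in> U \<Longrightarrow> p u = q u" for n U p q
      using that plot_cong[OF dV, of n U "\<lambda>u. ?g (p u)" "\<lambda>u. ?g (q u)"]
      by (auto simp: transport_diffspace_def image_subset_iff)
    show "(n, U, \<lambda>_. x) \<in> plots ?T" if "openin (Euclidean_space n) U" "x \<in> points ?T" for n U x
      using that plot_const[OF dV, of n U "?g x"] inv_into_into[of x e "points V"]
      by (auto simp: transport_diffspace_def)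
    show "(m, S, p \<circ> g) \<in> plots ?T" if "(n, U, p) \<in> plots ?T" "smooth_open_map m S n U g" for n U p m S g
      using that plot_compose[OF dV, of n U "\<lambda>u. ?g (p u)" m S g]
      by (auto simp: transport_diffspace_def comp_def smooth_open_map_def image_subset_iff)
    show "(n, \<Union>\<U>, p) \<in> plots ?T" if "\<And>U. U \<in> \<U> \<Longrightarrow> (n, U, p) \<in> plots ?T" for n \<U> p
      using that plot_Union[OF dV, of \<U> n "\<lambda>u. ?g (p u)"]
      by (auto simp: transport_diffspace_def image_subset_iff)
  qed (use plot_openin[OF dV] in \<open>auto simp: transport_diffspace_def\<close>)
  show "subspace (points ?T)"
    using linear_subspace_image[OF e dvect_subspace[OF V]] by (simp add: transport_diffspace_def)
  then have closed_add: "x + y \<in> e ` points V" if "x \<in> e ` points V" "y \<in> e ` points V" for x y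
    using that by (simp add: transport_diffspace_def subspace_add)
  have closed_scale: "r *\<^sub>R x \<in> e ` points V" if "x \<in> e ` points V" for x r
    using that \<open>subspace (points ?T)\<close> by (simp add: transport_diffspace_def subspace_scale)
  show "(n, U, \<lambda>u. p u + q u) \<in> plots ?T" if p: "(n, U, p) \<in> plots ?T" and q: "(n, U, q) \<in> plots ?T" for n U p q
  proof -
    have im: "p u \<in> e ` points V" "q u \<in> e ` points V" if "u \<in> U" for u
      using p q that by (auto simp: transport_diffspace_def)
    have "(n, U, \<lambda>u. ?g (p u) + ?g (q u)) \<in> plots V"
      using p q by (intro dvect_plot_add[OF V]) (auto simp: transport_diffspace_def)
    then have "(n, U, \<lambda>u. ?g (p u + q u)) \<in> plots V"
      by (rule plot_cong[OF dV]) (simp add: im inv_transport_add)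
    then show ?thesis using im closed_add closed_scale by (auto simp: transport_diffspace_def image_subset_iff)
  qed
  show "(n, U, \<lambda>u. r u *\<^sub>R p u) \<in> plots ?T" if r: "smooth_fun n U r" and p: "(n, U, p) \<in> plots ?T" for n U r p
  proof -
    have im: "p u \<in> e ` points V" if "u \<in> U" for u
      using p that by (auto simp: transport_diffspace_def)
    have "(n, U, \<lambda>u. r u *\<^sub>R ?g (p u)) \<in> plots V"
      using p r by (intro dvect_plot_scale[OF V]) (auto simp: transport_diffspace_def)
    then have "(n, U, \<lambda>u. ?g (r u *\<^sub>R p u)) \<in> plots V"
      by (rule plot_cong[OF dV]) (simp add: im inv_transport_scale)
    then show ?thesis using im closed_add closed_scale by (auto simp: transport_diffspace_def image_subset_iff)
  qed
qed

end

text \<open>A set-theoretic linear section of \<open>f\<close> is enough to embed \<open>V\<close> into the universe of \<open>W\<close>.\<close>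

lemma projective_in_section:
  fixes V :: "'a::real_vector diffspace" and W :: "'b::real_vector diffspace"
    and \<iota> :: "'b \<Rightarrow> 'w::real_vector"
  assumes \<iota>: "linear \<iota>" "inj \<iota>"
    and V: "diffeological_vector_space V" and W: "diffeological_vector_space W"
    and proj: "projective_in TYPE('w) V" and f: "linear_subduction W V f" "linear f"
  shows "\<exists>h. smooth_linear V W h \<and> (\<forall>x\<in>points V. f (h x) = x)"
proof -
  have fs: "smooth_linear W V f" and fW: "f ` points W = points V"
    using f(1) by (auto simp: linear_subduction_def)
  obtain s where s: "linear s" "\<And>x. x \<in> points V \<Longrightarrow> f (s x) = x"
    using linear_exists_right_inverse_on[OF f(2) dvect_subspace[OF W]] fW by auto
  \<comment> \<open>\<open>s\<close> places \<open>V\<close> inside the type of \<open>W\<close>,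
    and \<open>\<iota>\<close> moves it on into \<open>'w\<close>. Injectivity on \<open>V\<close>
    holds because \<open>f\<close> undoes \<open>s\<close> there.\<close>
  define e where "e = \<iota> \<circ> s"
  have e: "linear e" using linear_compose[OF s(1) \<iota>(1)] by (simp add: e_def)
  have "inj_on s (points V)" by (rule inj_on_inverseI[of _ f]) (use s in auto)
  then have e_inj: "inj_on e (points V)"
    unfolding e_def by (rule comp_inj_on) (rule inj_on_subset[OF \<iota>(2)], simp)
  have \<iota>_inj: "inj_on \<iota> (points W)" using \<iota>(2) by (rule inj_on_subset) simp
  let ?W1 = "transport_diffspace \<iota> W" and ?W2 = "transport_diffspace e V"
  let ?g = "inv_into (points W) \<iota>"
  note g = smooth_linear_inv_transport[OF \<iota>(1) \<iota>_inj W]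
  note \<iota>s = smooth_linear_transport[OF \<iota>(1) \<iota>_inj W]
  note es = smooth_linear_transport[OF e e_inj V]
  \<comment> \<open>This is \<open>f\<close> seen through the two copies. A plot of the copy of
    \<open>V\<close> is read back in \<open>V\<close>, lifted along \<open>f\<close>, and pushed
    forward by \<open>\<iota>\<close>.\<close>
  have sub: "linear_subduction ?W1 ?W2 (\<lambda>x. e (f (?g x)))"
    unfolding linear_subduction_def
  proof (intro conjI allI impI ballI)
    show "smooth_linear ?W1 ?W2 (\<lambda>x. e (f (?g x)))"
      using smooth_linear_compose[OF smooth_linear_compose[OF g fs] es] .
    have "(\<lambda>x. e (f (?g x))) ` \<iota> ` points W = e ` f ` points W"
      unfolding image_image by (rule image_cong[OF refl]) (simp add: inv_into_f_f[OF \<iota>_inj])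
    then show "(\<lambda>x. e (f (?g x))) ` points ?W1 = points ?W2"
      by (simp add: fW transport_diffspace_def)
    fix n U p u assume p: "(n, U, p) \<in> plots ?W2" and u: "u \<in> U"
    let ?p = "\<lambda>u. inv_into (points V) e (p u)"
    have "(n, U, ?p) \<in> plots V" using p by (simp add: transport_diffspace_def)
    then obtain U' q where U': "openin (Euclidean_space n) U'" "u \<in> U'" "U' \<subseteq> U"
        and q: "(n, U', q) \<in> plots W" "\<forall>x\<in>U'. f (q x) = ?p x"
      using f(1) u unfolding linear_subduction_def by meson
    have "e (f (?g (\<iota> (q x)))) = p x" if "x \<in> U'" for x
    proof -
      have "q x \<in> points W" using plot_in_points[OF dvect_diffeological[OF W] q(1) that] .
      moreover have "p x \<in> e ` points V" using p U'(3) that by (auto simp: transport_diffspace_def)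
      ultimately show ?thesis using q(2) that \<iota>_inj by (simp add: f_inv_into_f)
    qed
    then show "\<exists>U' q. openin (Euclidean_space n) U' \<and> u \<in> U' \<and> U' \<subseteq> U \<and>
        (n, U', q) \<in> plots ?W1 \<and> (\<forall>x\<in>U'. e (f (?g (q x))) = p x)"
      using U' smooth_linear_plot[OF \<iota>s q(1)] by (intro exI[of _ U'] exI[of _ "\<lambda>x. \<iota> (q x)"]) auto
  qed
  \<comment> \<open>Projectivity is applied to \<open>e\<close>, which stands for the identity of
    \<open>V\<close>. Reading the lift back in \<open>W\<close> gives a section of \<open>f\<close>
    once \<open>e\<close> is cancelled.\<close>
  obtain k where k: "smooth_linear V ?W1 k" "\<forall>x\<in>points V. e x = e (f (?g (k x)))"
    using proj[unfolded projective_in_def, rule_format, of ?W1 ?W2 "\<lambda>x. e (f (?g x))" e] sub es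
      diffeological_vector_space_transport[OF \<iota>(1) \<iota>_inj W]
      diffeological_vector_space_transport[OF e e_inj V] by blast
  have gk: "smooth_linear V W (\<lambda>x. ?g (k x))" using smooth_linear_compose[OF k(1) g] .
  have "f (?g (k x)) = x" if "x \<in> points V" for x
    using inj_onD[OF e_inj, of "f (?g (k x))" x] k(2) that
      smooth_linear_points[OF fs smooth_linear_points[OF gk that]] by simp
  with gk show ?thesis by blast
qed

section \<open>The linear subduction given by all plots\<close>

text \<open>Indexing by the triples themselves gives each plot a summand of its own. Triples that
  differ only off their domain yield repeated summands, which does no harm.\<close>

abbreviation plot_cover :: "'a::real_vector diffspace \<Rightarrow> ('a plot \<Rightarrow>\<^sub>0 (pt \<Rightarrow>\<^sub>0 real)) diffspace" where
  "plot_cover V \<equiv> coproduct_dvect (plots V) (\<lambda>i. free_dvect (open_diffspace (fst i) (fst (snd i))))"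

definition plot_evaluation :: "('a plot \<Rightarrow>\<^sub>0 (pt \<Rightarrow>\<^sub>0 real)) \<Rightarrow> 'a::real_vector" where
  "plot_evaluation = linear_extension (\<lambda>i. linear_extension (\<lambda>x r. r *\<^sub>R snd (snd i) x))"

text \<open>The defining formula makes sense for all triples, not only for plots, hence linearity on
  the whole type. This is what allows \<open>projective_in_section\<close> to choose a linear right
  inverse.\<close>

lemma linear_plot_evaluation: "linear plot_evaluation"
  unfolding plot_evaluation_def by (intro linear_linear_extension linear_scaleR_vector)

lemma plot_evaluation_single:
  "plot_evaluation (Poly_Mapping.single i (Poly_Mapping.single x 1)) = snd (snd i) x"
  unfolding plot_evaluation_def
  by (simp add: linear_extension_single linear_linear_extension linear_scaleR_vector)

context
  fixes V :: "'a::real_vector diffspace"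
  assumes V: "diffeological_vector_space V"
begin

lemma plot_domain_diffeological:
  "i \<in> plots V \<Longrightarrow> diffeological_space (open_diffspace (fst i) (fst (snd i)))"
  using plot_openin[OF dvect_diffeological[OF V]] by (intro diffeological_open) (metis prod.collapse)

lemma diffeological_vector_space_plot_cover: "diffeological_vector_space (plot_cover V)"
  by (intro diffeological_vector_space_coproduct diffeological_vector_space_free
      plot_domain_diffeological)

lemma smooth_linear_plot_evaluation: "smooth_linear (plot_cover V) V plot_evaluation"
proof (rule smooth_linear_linear[OF linear_plot_evaluation])
  have "smooth_map (free_dvect (open_diffspace (fst i) (fst (snd i)))) V
      (linear_extension (\<lambda>x r. r *\<^sub>R snd (snd i) x))" if "i \<in> plots V" for i
    using that by (intro smooth_map_free plot_domain_diffeological V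
        smooth_map_open_plot dvect_diffeological) auto
  then show "smooth_map (plot_cover V) V plot_evaluation"
    unfolding plot_evaluation_def
    by (intro smooth_map_coproduct V diffeological_vector_space_free plot_domain_diffeological
        linear_linear_extension linear_scaleR_vector) auto
qed

lemma tautological_plot:
  assumes p: "(n, U, p) \<in> plots V"
  shows "(n, U, \<lambda>u. Poly_Mapping.single (n, U, p) (Poly_Mapping.single u 1)) \<in> plots (plot_cover V)"
proof -
  have U: "openin (Euclidean_space n) U" using plot_openin[OF dvect_diffeological[OF V] p] .
  have "(n, U, \<lambda>u. u) \<in> plots (open_diffspace n U)"
    using smooth_open_map_id[OF U U] by (simp add: open_diffspace_def)
  then have "(n, U, \<lambda>u. \<Sum>i<1::nat. Poly_Mapping.single u 1) \<in> plots (free_dvect (open_diffspace n U))"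
    by (intro free_plot diffeological_open U smooth_fun_const) auto
  then have *: "(n, U, \<lambda>u. Poly_Mapping.single u 1) \<in> plots (free_dvect (open_diffspace n U))"
    by simp
  have "(n, U, \<lambda>u. \<Sum>j\<in>{(n, U, p)}. Poly_Mapping.single j (Poly_Mapping.single u 1)) \<in> plots (plot_cover V)"
    by (rule coproduct_plot)
      (use p U * in \<open>auto intro: diffeological_vector_space_free plot_domain_diffeological\<close>)
  then show ?thesis by simp
qed

lemma linear_subduction_plot_evaluation: "linear_subduction (plot_cover V) V plot_evaluation"
  unfolding linear_subduction_def
proof (intro conjI allI impI ballI smooth_linear_plot_evaluation)
  note dV = dvect_diffeological[OF V]
  show "plot_evaluation ` points (plot_cover V) = points V"
  proof
    show "plot_evaluation ` points (plot_cover V) \<subseteq> points V"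
      using smooth_linear_points[OF smooth_linear_plot_evaluation] by blast
    show "points V \<subseteq> plot_evaluation ` points (plot_cover V)"
    proof
      fix x assume "x \<in> points V"
      \<comment> \<open>Surjectivity comes from constant plots on the one-point space R^0: the basis
        element of that point, in the summand of the constant plot, is sent to
        \<open>x\<close>.\<close>
      then have "(0, topspace (Euclidean_space 0), \<lambda>_. x) \<in> plots V"
        by (intro plot_const[OF dV]) auto
      from plot_in_points[OF dvect_diffeological[OF diffeological_vector_space_plot_cover]
          tautological_plot[OF this], of "\<lambda>_. 0"]
      show "x \<in> plot_evaluation ` points (plot_cover V)"
        by (rule rev_image_eqI) (auto simp: topspace_Euclidean_space plot_evaluation_single)
    qed
  qed
  fix n U p u assume p: "(n, U, p) \<in> plots V" and u: "u \<in> U"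
  \<comment> \<open>The tautological lift exists on all of \<open>U\<close>, without shrinking the
    domain.\<close>
  show "\<exists>U' q. openin (Euclidean_space n) U' \<and> u \<in> U' \<and> U' \<subseteq> U \<and>
      (n, U', q) \<in> plots (plot_cover V) \<and> (\<forall>x\<in>U'. plot_evaluation (q x) = p x)"
    using plot_openin[OF dV p] u tautological_plot[OF p]
    by (intro exI[of _ U] exI[of _ "\<lambda>u. Poly_Mapping.single (n, U, p) (Poly_Mapping.single u 1)"])
      (simp add: plot_evaluation_single)
qed

end

text \<open>The map \<open>\<iota>\<close> expresses that \<open>'w\<close> is large enough to hold
  the coproduct over all plots of \<open>V\<close>; the type of that coproduct with the identity map
  is one admissible choice.\<close>

theorem corollary6p13:
  fixes V :: "'a::real_vector diffspace"
    and \<iota> :: "('a plot \<Rightarrow>\<^sub>0 (pt \<Rightarrow>\<^sub>0 real)) \<Rightarrow> 'w::real_vector"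
  assumes large_universe: "linear \<iota>" "inj \<iota>"
    and "diffeological_vector_space V"
    and "projective_in TYPE('w) V"
  shows "\<exists>(I :: 'a plot set) (n :: 'a plot \<Rightarrow> nat) (U :: 'a plot \<Rightarrow> pt set).
           (\<forall>i\<in>I. openin (Euclidean_space (n i)) (U i)) \<and>
           smooth_direct_summand V
             (coproduct_dvect I (\<lambda>i. free_dvect (open_diffspace (n i) (U i))))"
proof -
  note V = \<open>diffeological_vector_space V\<close>
  obtain h where "smooth_linear V (plot_cover V) h" "\<forall>x\<in>points V. plot_evaluation (h x) = x"
    using projective_in_section[OF large_universe V diffeological_vector_space_plot_cover[OF V]
        assms(4) linear_subduction_plot_evaluation[OF V] linear_plot_evaluation] by blast
  then have "smooth_direct_summand V (plot_cover V)"
    by (intro smooth_direct_summandI[OF V diffeological_vector_space_plot_cover[OF V]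
          smooth_linear_plot_evaluation[OF V]]) auto
  moreover have "\<forall>i\<in>plots V. openin (Euclidean_space (fst i)) (fst (snd i))"
    using plot_openin[OF dvect_diffeological[OF V]] by auto
  ultimately show ?thesis
    by (intro exI[of _ "plots V"] exI[of _ fst] exI[of _ "\<lambda>i. fst (snd i)"] conjI)
qed

end
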